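(* Let $k\ge 1$ and let $D$ be a digraph with a feedback arc set $F$ of size at most $k^2-1$. Then $D$ is $k$-colorable if and only if $D[V(F)]$ is $k$-colorable, and such a coloring can be extended to a $k$-coloring of $D$ in polynomial time.
   Context: Digraphs are loopless and have no parallel arcs, but digons are allowed. A digraph is $k$-colorable if its vertices can be colored with $k$ colors so that each color class induces an acyclic subdigraph. A feedback arc set of $D$ is a set $F$ of arcs such that $D-F$ is acyclic. $V(F)$ denotes the set of endpoints of arcs of $F$, and $D[S]$ the subdigraph induced by a vertex set $S$.
   Formalization: "Extended" is read as: from any k-coloring of D[V(F)] a k-coloring of D is computed in polynomial time, possibly recoloring vertices of V(F); an extension agreeing on V(F) can fail, e.g. k=2, triangles uvx and abx, F={uv,ab}, u,v colored 0 and a,b colored 1. *)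

theory Defs
  imports "Graph_Theory.Graph_Theory" "HOL-Computational_Algebra.Polynomial"
begin

section \<open>Digraph coloring and feedback arc sets\<close>

text \<open>
  The locale \<^locale>\<open>digraph\<close> is the class of finite digraphs without loops and parallel arcs.
  Digons are allowed, and a digon is a cycle in the sense of \<^const>\<open>pre_digraph.cycle\<close>.
\<close>

definition acyclic_digraph :: "('a,'b) pre_digraph \<Rightarrow> bool" where
  "acyclic_digraph D \<longleftrightarrow> (\<nexists>p. pre_digraph.cycle D p)"

definition del_arcs :: "('a,'b) pre_digraph \<Rightarrow> 'b set \<Rightarrow> ('a,'b) pre_digraph" where
  "del_arcs D F = D\<lparr>arcs := arcs D - F\<rparr>"

definition feedback_arc_set :: "('a,'b) pre_digraph \<Rightarrow> 'b set \<Rightarrow> bool" where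
  "feedback_arc_set D F \<longleftrightarrow> F \<subseteq> arcs D \<and> acyclic_digraph (del_arcs D F)"

definition endpoints :: "('a,'b) pre_digraph \<Rightarrow> 'b set \<Rightarrow> 'a set" where
  "endpoints D F = tail D ` F \<union> head D ` F"

definition is_coloring :: "nat \<Rightarrow> ('a,'b) pre_digraph \<Rightarrow> ('a \<Rightarrow> nat) \<Rightarrow> bool" where
  "is_coloring k D c \<longleftrightarrow>
     (\<forall>v\<in>verts D. c v < k) \<and>
     (\<forall>i<k. acyclic_digraph (D \<restriction> {v \<in> verts D. c v = i}))"

definition colorable :: "nat \<Rightarrow> ('a,'b) pre_digraph \<Rightarrow> bool" where
  "colorable k D \<longleftrightarrow> (\<exists>c. is_coloring k D c)"


section \<open>A model of computation\<close>

text \<open>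
  While-programs over binary trees (Jones, \<^emph>\<open>Computability and Complexity\<close>), extended by an
  equality test. Time is not counted per operation: evaluating an expression costs the number of
  nodes of the value of each of its subexpressions, so that copying, decomposing or comparing trees
  is charged linearly in their size, and no value is larger than the input plus the time spent.
  Hence running time agrees with that of Turing machines up to a polynomial.
\<close>

datatype tree = Leaf | Node tree tree

primrec nodes :: "tree \<Rightarrow> nat" where
  "nodes Leaf = 1"
| "nodes (Node a b) = 1 + nodes a + nodes b"

primrec left :: "tree \<Rightarrow> tree" where
  "left Leaf = Leaf"
| "left (Node a b) = a"

primrec right :: "tree \<Rightarrow> tree" where
  "right Leaf = Leaf"
| "right (Node a b) = b"

type_synonym state = "nat \<Rightarrow> tree"

datatype expr =
    EVar nat
  | ELeaf
  | ENode expr expr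
  | ELeft expr
  | ERight expr
  | EEq expr expr

primrec eval :: "expr \<Rightarrow> state \<Rightarrow> tree" where
  "eval (EVar x) s = s x"
| "eval ELeaf s = Leaf"
| "eval (ENode e f) s = Node (eval e s) (eval f s)"
| "eval (ELeft e) s = left (eval e s)"
| "eval (ERight e) s = right (eval e s)"
| "eval (EEq e f) s = (if eval e s = eval f s then Node Leaf Leaf else Leaf)"

primrec cost :: "expr \<Rightarrow> state \<Rightarrow> nat" where
  "cost (EVar x) s = nodes (s x)"
| "cost ELeaf s = 1"
| "cost (ENode e f) s = cost e s + cost f s + nodes (eval (ENode e f) s)"
| "cost (ELeft e) s = cost e s + nodes (eval (ELeft e) s)"
| "cost (ERight e) s = cost e s + nodes (eval (ERight e) s)"
| "cost (EEq e f) s = cost e s + cost f s + nodes (eval (EEq e f) s)"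

datatype com =
    Skip
  | Assign nat expr
  | Seq com com
  | Cond expr com com
  | While expr com

text \<open>
  \<open>exec c s t s'\<close>: program \<open>c\<close>, started in state \<open>s\<close>, halts after time \<open>t\<close> in state \<open>s'\<close>.
  A test succeeds iff its value is not \<^const>\<open>Leaf\<close>.
\<close>

inductive exec :: "com \<Rightarrow> state \<Rightarrow> nat \<Rightarrow> state \<Rightarrow> bool" where
  Skip: "exec Skip s 1 s"
| Assign: "exec (Assign x e) s (1 + cost e s) (s(x := eval e s))"
| Seq: "exec c s t s' \<Longrightarrow> exec d s' t' s'' \<Longrightarrow> exec (Seq c d) s (1 + t + t') s''"
| CondTrue: "eval e s \<noteq> Leaf \<Longrightarrow> exec c s t s' \<Longrightarrow> exec (Cond e c d) s (1 + cost e s + t) s'"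
| CondFalse: "eval e s = Leaf \<Longrightarrow> exec d s t s' \<Longrightarrow> exec (Cond e c d) s (1 + cost e s + t) s'"
| WhileFalse: "eval e s = Leaf \<Longrightarrow> exec (While e c) s (1 + cost e s) s"
| WhileTrue: "eval e s \<noteq> Leaf \<Longrightarrow> exec c s t s' \<Longrightarrow> exec (While e c) s' t' s'' \<Longrightarrow>
    exec (While e c) s (1 + cost e s + t + t') s''"

text \<open>Variable 0 holds the input and, on termination, the output.\<close>

definition computes :: "com \<Rightarrow> tree \<Rightarrow> nat \<Rightarrow> tree \<Rightarrow> bool" where
  "computes c x t y \<longleftrightarrow> (\<exists>s'. exec c ((\<lambda>_. Leaf)(0 := x)) t s' \<and> s' 0 = y)"

inductive_cases exec_elims:
  "exec Skip s t s'"
  "exec (Assign x e) s t s'"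
  "exec (Seq c d) s t s'"
  "exec (Cond e c d) s t s'"
  "exec (While e c) s t s'"

lemma exec_deterministic: "exec c s t s' \<Longrightarrow> exec c s u s'' \<Longrightarrow> u = t \<and> s'' = s'"
proof (induction arbitrary: u s'' rule: exec.induct)
  case Skip
  from Skip.prems show ?case by (rule exec_elims(1)) simp
next
  case Assign
  from Assign.prems show ?case by (rule exec_elims(2)) simp
next
  case Seq
  from Seq.prems show ?case by (rule exec_elims(3)) (metis plus_1_eq_Suc add_Suc Seq.IH)
next
  case CondTrue
  from CondTrue.prems show ?case by (rule exec_elims(4)) (metis plus_1_eq_Suc add_Suc CondTrue.IH CondTrue.hyps(1))+
next
  case CondFalse
  from CondFalse.prems show ?case by (rule exec_elims(4)) (metis plus_1_eq_Suc add_Suc CondFalse.IH CondFalse.hyps(1))+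
next
  case WhileFalse
  from WhileFalse.prems show ?case by (rule exec_elims(5)) (metis plus_1_eq_Suc add_Suc WhileFalse.hyps)+
next
  case WhileTrue
  from WhileTrue.prems show ?case by (rule exec_elims(5)) (metis plus_1_eq_Suc add_Suc WhileTrue.IH WhileTrue.hyps(1))+
qed

lemma computes_deterministic: "computes c x t y \<Longrightarrow> computes c x u z \<Longrightarrow> u = t \<and> z = y"
  unfolding computes_def by (metis exec_deterministic)


section \<open>Encodings\<close>

text \<open>Natural numbers are encoded in binary, least significant bit first.\<close>

fun enc_nat :: "nat \<Rightarrow> tree" where
  "enc_nat n = (if n = 0 then Leaf
     else Node (if odd n then Node Leaf Leaf else Leaf) (enc_nat (n div 2)))"

declare enc_nat.simps [simp del]

definition enc_pair :: "nat \<times> nat \<Rightarrow> tree" where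
  "enc_pair p = Node (enc_nat (fst p)) (enc_nat (snd p))"

definition enc_list :: "('a \<Rightarrow> tree) \<Rightarrow> 'a list \<Rightarrow> tree" where
  "enc_list f xs = foldr (\<lambda>x. Node (f x)) xs Leaf"

definition lists_set :: "'a list \<Rightarrow> 'a set \<Rightarrow> bool" where
  "lists_set xs A \<longleftrightarrow> distinct xs \<and> set xs = A"

text \<open>The values of a coloring on the vertex set \<open>S\<close>, as a list of pairs (vertex, color).\<close>

definition encodes_coloring :: "nat set \<Rightarrow> (nat \<Rightarrow> nat) \<Rightarrow> tree \<Rightarrow> bool" where
  "encodes_coloring S c x \<longleftrightarrow>
     (\<exists>cs. lists_set cs ((\<lambda>v. (v, c v)) ` S) \<and> x = enc_list enc_pair cs)"

text \<open>
  To extend a coloring of \<open>D[V(F)]\<close> to one of \<open>D\<close> means to transform it into a coloring of \<open>D\<close>;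
  vertices of \<open>V(F)\<close> may have to be recolored. Let \<open>D\<close> consist of the directed triangles \<open>u v x\<close> and
  \<open>a b x\<close>, let \<open>F = {uv, ab}\<close> and \<open>k = 2\<close>: coloring \<open>u, v\<close> with 0 and \<open>a, b\<close> with 1 is valid on
  \<open>D[V(F)]\<close>, but then neither color is possible for \<open>x\<close>.
\<close>

text \<open>The number of colors, the vertices and arcs of \<open>D\<close>, the set \<open>F\<close>, and a coloring of \<open>V(F)\<close>.\<close>

definition encodes_instance ::
  "nat \<Rightarrow> nat pair_pre_digraph \<Rightarrow> (nat \<times> nat) set \<Rightarrow> (nat \<Rightarrow> nat) \<Rightarrow> tree \<Rightarrow> bool" where
  "encodes_instance k D F c x \<longleftrightarrow>
     (\<exists>vs es fs y. lists_set vs (pverts D) \<and> lists_set es (parcs D) \<and> lists_set fs F \<and>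
        encodes_coloring (endpoints (with_proj D) F) c y \<and>
        x = Node (enc_nat k) (Node (enc_list enc_nat vs)
              (Node (enc_list enc_pair es) (Node (enc_list enc_pair fs) y))))"

lemma enc_nat_0: "enc_nat 0 = Leaf"
  by (subst enc_nat.simps) simp

lemma enc_nat_pos:
  "n \<noteq> 0 \<Longrightarrow> enc_nat n = Node (if odd n then Node Leaf Leaf else Leaf) (enc_nat (n div 2))"
  by (subst enc_nat.simps) (simp only: if_False)

lemma enc_nat_inject: "enc_nat m = enc_nat n \<longleftrightarrow> m = n"
proof (induction m arbitrary: n rule: less_induct)
  case (less m)
  consider "m = 0" "n = 0" | "m = 0" "n \<noteq> 0" | "m \<noteq> 0" "n = 0" | "m \<noteq> 0" "n \<noteq> 0"
    by blast
  then show ?case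
  proof cases
    case 2
    then show ?thesis using enc_nat_0 enc_nat_pos[of n] by simp
  next
    case 3
    then show ?thesis using enc_nat_0 enc_nat_pos[of m] by simp
  next
    case 4
    have IH: "enc_nat (m div 2) = enc_nat (n div 2) \<longleftrightarrow> m div 2 = n div 2"
      using 4 by (intro less.IH) simp
    have "enc_nat m = enc_nat n \<longleftrightarrow> (odd m \<longleftrightarrow> odd n) \<and> m div 2 = n div 2"
      unfolding enc_nat_pos[OF 4(1)] enc_nat_pos[OF 4(2)] tree.inject IH by simp
    also have "\<dots> \<longleftrightarrow> m = n"
      by presburger
    finally show ?thesis .
  qed simp
qed

end

theory Submission
  imports Defs
begin

text \<open>
  Call a color free if no arc of \<open>F\<close> has both ends in its class. A cycle meets \<open>F\<close>, so free classes are
  acyclic however many further vertices they receive, provided that they stay free. It therefore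
  suffices to find a nonempty set \<open>A\<close> of colors such that the vertices of \<open>V(F)\<close> with colors in \<open>A\<close> can
  be recolored from \<open>A\<close> with no monochromatic arc of \<open>F\<close>: the vertices outside \<open>V(F)\<close> then take any
  color in \<open>A\<close>, and the other classes are unchanged.

  Start with all \<open>k\<close> colors. As long as some class of \<open>A\<close> has two vertices that are incident with at
  least \<open>|A|\<close> arcs of \<open>F\<close> inside the classes of \<open>A\<close>, remove its color from \<open>A\<close>. As the class contains no
  digon, this discards at least \<open>2|A| - 1 = |A|\<^sup>2 - (|A| - 1)\<^sup>2\<close> arcs of \<open>F\<close>, so fewer than \<open>|A|\<^sup>2\<close> arcs
  of \<open>F\<close> remain throughout and \<open>A\<close> never becomes empty. At the end each class of \<open>A\<close> has at most one
  vertex of high degree. These vertices keep their colors, which are distinct, and all other vertices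
  are colored greedily.
\<close>

section \<open>The recoloring algorithm\<close>

text \<open>Membership in \<open>A\<close> is spelled out as a search with an equality test, so that
  the version on trees has the same shape and is covered by \<open>pdec_bex\<close> and
  \<open>pdec_eq\<close>.\<close>

definition has_color :: "('a \<times> nat) list \<Rightarrow> nat list \<Rightarrow> 'a \<Rightarrow> bool" where
  "has_color cs A v \<longleftrightarrow> (\<exists>p\<in>set cs. fst p = v \<and> (\<exists>j\<in>set A. j = snd p))"

definition arcs_within :: "('a \<times> nat) list \<Rightarrow> ('a \<times> 'a) list \<Rightarrow> nat list \<Rightarrow> ('a \<times> 'a) list" where
  "arcs_within cs fs A = filter (\<lambda>e. has_color cs A (fst e) \<and> has_color cs A (snd e)) fs"

text \<open>The threshold is the one for greedy coloring: below it, the neighbors along these arcs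
  cannot block all colors of \<open>A\<close>.\<close>

definition high :: "('a \<times> nat) list \<Rightarrow> ('a \<times> 'a) list \<Rightarrow> nat list \<Rightarrow> 'a \<Rightarrow> bool" where
  "high cs fs A v \<longleftrightarrow> length A \<le> length (filter (\<lambda>e. fst e = v \<or> snd e = v) (arcs_within cs fs A))"

definition crowded :: "('a \<times> nat) list \<Rightarrow> ('a \<times> 'a) list \<Rightarrow> nat list \<Rightarrow> nat \<Rightarrow> bool" where
  "crowded cs fs A i \<longleftrightarrow> (\<exists>p\<in>set cs. \<exists>q\<in>set cs. snd p = i \<and> snd q = i \<and> fst p \<noteq> fst q \<and>
     high cs fs A (fst p) \<and> high cs fs A (fst q))"

text \<open>The default 0 matches \<open>left Leaf = Leaf\<close> under the encoding, because
  \<open>enc_nat 0 = Leaf\<close>; hence \<open>left_enc_list\<close> holds without a case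
  distinction.\<close>

fun first :: "nat list \<Rightarrow> nat" where
  "first [] = 0"
| "first (i # is) = i"

definition shrink :: "('a \<times> nat) list \<Rightarrow> ('a \<times> 'a) list \<Rightarrow> nat list \<Rightarrow> nat list" where
  "shrink cs fs A = (if filter (crowded cs fs A) A = [] then A
     else filter (\<lambda>j. j \<noteq> first (filter (crowded cs fs A) A)) A)"

text \<open>The list being folded over only counts rounds. There are as many rounds as colors, which
  suffices since each round that changes anything removes a color.\<close>

definition free_colors :: "('a \<times> nat) list \<Rightarrow> ('a \<times> 'a) list \<Rightarrow> nat list \<Rightarrow> nat list" where
  "free_colors cs fs K = fold (\<lambda>_. shrink cs fs) K K"

text \<open>
  The palette is capped at \<open>|F| + 1\<close> colors, because \<open>k\<close> is given in binary and may be exponentially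
  large.
\<close>

definition palette :: "nat \<Rightarrow> 'b list \<Rightarrow> nat list" where
  "palette k fs = fold (\<lambda>_ K. if Suc (first K) = k then K else Suc (first K) # K) fs [0]"

definition blocked :: "('a \<times> 'a) list \<Rightarrow> ('a \<times> nat) list \<Rightarrow> 'a \<Rightarrow> nat \<Rightarrow> bool" where
  "blocked es R v i \<longleftrightarrow> (\<exists>e\<in>set es. \<exists>p\<in>set R. snd p = i \<and>
     (fst e = v \<and> snd e = fst p \<or> snd e = v \<and> fst e = fst p))"

definition greedy_step ::
  "('a \<times> 'a) list \<Rightarrow> nat list \<Rightarrow> 'a \<Rightarrow> ('a \<times> nat) list \<Rightarrow> ('a \<times> nat) list" where
  "greedy_step es A v R = (if \<exists>p\<in>set R. fst p = v then R
     else (v, first (filter (\<lambda>i. \<not> blocked es R v i) A)) # R)"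

text \<open>The start list retains the vertices whose color lies outside \<open>A\<close> and the
  high ones; \<open>greedy_step\<close> never overwrites an entry. Only arcs of F within the classes
  of \<open>A\<close> can block a color.\<close>

definition greedy ::
  "'a list \<Rightarrow> ('a \<times> 'a) list \<Rightarrow> ('a \<times> nat) list \<Rightarrow> nat list \<Rightarrow> ('a \<times> nat) list" where
  "greedy vs fs cs A = fold (greedy_step (arcs_within cs fs A) A) vs
     (filter (\<lambda>p. \<not> (\<exists>j\<in>set A. j = snd p) \<or> high cs fs A (fst p)) cs)"

definition recolor ::
  "nat \<Rightarrow> 'a list \<Rightarrow> ('a \<times> 'a) list \<Rightarrow> ('a \<times> nat) list \<Rightarrow> ('a \<times> nat) list" where
  "recolor k vs fs cs = greedy vs fs cs (free_colors cs fs (palette k fs))"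

section \<open>Correctness of the recoloring on lists\<close>

lemma first_in_set: "xs \<noteq> [] \<Longrightarrow> first xs \<in> set xs"
  by (cases xs) simp_all

lemma palette_eq:
  assumes "1 \<le> k"
  shows "palette k fs = rev [0..<min k (Suc (length fs))]"
proof -
  \<comment> \<open>Generalized to a start list whose head is its largest color \<open>m\<close>;
    the list becomes stationary once \<open>Suc m = k\<close>.\<close>
  have "fold (\<lambda>_ K. if Suc (first K) = k then K else Suc (first K) # K) fs (rev [0..<Suc m])
      = rev [0..<min k (Suc m + length fs)]" if "Suc m \<le> k" for m
    using that
  proof (induction fs arbitrary: m)
    case (Cons f fs)
    have "first (rev [0..<Suc m]) = m" by simp
    then show ?case
      using Cons.IH[of m] Cons.IH[of "Suc m"] Cons.prems
      by (cases "Suc m = k") (auto simp: min_def)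
  qed (simp add: min_def)
  from this[of 0] assms show ?thesis by (simp add: palette_def)
qed

text \<open>Here \<open>S\<close> stands for V(F) and \<open>fs\<close> lists the arcs of F as pairs
  of ends. Of the acyclicity of the classes of \<open>c\<close>, the combinatorial argument retains
  just the absence of monochromatic digons.\<close>

locale feedback_coloring =
  fixes c :: "'a \<Rightarrow> nat" and S :: "'a set" and cs :: "('a \<times> nat) list" and fs :: "('a \<times> 'a) list"
  assumes distinct_fs: "distinct fs"
    and set_cs: "set cs = (\<lambda>v. (v, c v)) ` S"
    and distinct_cs: "distinct cs"
    and ends: "(u, v) \<in> set fs \<Longrightarrow> u \<in> S \<and> v \<in> S"
    and loopless: "(u, v) \<in> set fs \<Longrightarrow> u \<noteq> v"
    and no_mono_digon: "(u, v) \<in> set fs \<Longrightarrow> (v, u) \<in> set fs \<Longrightarrow> c u \<noteq> c v"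
begin

section \<open>Counting arcs and removing crowded colors\<close>

lemma has_color_iff: "has_color cs A v \<longleftrightarrow> v \<in> S \<and> c v \<in> set A"
  by (auto simp: has_color_def set_cs)

lemma set_arcs_within:
  "set (arcs_within cs fs A) = {(u, v) \<in> set fs. c u \<in> set A \<and> c v \<in> set A}"
  by (auto simp: arcs_within_def has_color_iff dest: ends)

lemma distinct_arcs_within: "distinct (arcs_within cs fs A)"
  by (simp add: arcs_within_def distinct_fs)

lemma crowded_iff:
  "crowded cs fs A i \<longleftrightarrow>
    (\<exists>u\<in>S. \<exists>v\<in>S. c u = i \<and> c v = i \<and> u \<noteq> v \<and> high cs fs A u \<and> high cs fs A v)"
  by (auto simp: crowded_def set_cs)

lemma high_iff:
  "high cs fs A v \<longleftrightarrow> length A \<le> card {e \<in> set (arcs_within cs fs A). fst e = v \<or> snd e = v}"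
  using distinct_card[of "filter (\<lambda>e. fst e = v \<or> snd e = v) (arcs_within cs fs A)"]
  by (simp add: high_def distinct_arcs_within)

text \<open>
  Two vertices of one class share at most one arc, because the class contains no digon.
\<close>

lemma arcs_within_remove_crowded:
  assumes "crowded cs fs A i"
  shows "length (arcs_within cs fs (filter (\<lambda>j. j \<noteq> i) A)) + 2 * length A
    \<le> length (arcs_within cs fs A) + 1"
proof -
  let ?A' = "filter (\<lambda>j. j \<noteq> i) A"
  let ?E = "set (arcs_within cs fs A)"
  let ?I = "\<lambda>v. {e \<in> ?E. fst e = v \<or> snd e = v}"
  from assms obtain u v where uv: "c u = i" "c v = i" "u \<noteq> v" "high cs fs A u" "high cs fs A v"
    unfolding crowded_iff by blast
  have "(u, v) \<notin> ?E \<or> (v, u) \<notin> ?E"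
    using no_mono_digon[of u v] uv by (auto simp: set_arcs_within)
  then obtain p where "?I u \<inter> ?I v \<subseteq> {p}"
  proof
    assume "(u, v) \<notin> ?E"
    then show thesis using uv(3) by (intro that[of "(v, u)"]) auto
  next
    assume "(v, u) \<notin> ?E"
    then show thesis using uv(3) by (intro that[of "(u, v)"]) auto
  qed
  then have "card (?I u \<inter> ?I v) \<le> 1"
    using card_mono[of "{p}" "?I u \<inter> ?I v"] by simp
  moreover have "card (?I u) + card (?I v) = card (?I u \<union> ?I v) + card (?I u \<inter> ?I v)"
    by (rule card_Un_Int) auto
  ultimately have I: "2 * length A \<le> card (?I u \<union> ?I v) + 1"
    using uv(4,5) by (simp add: high_iff)
  \<comment> \<open>Every arc at \<open>u\<close> or \<open>v\<close> has an end of color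
    \<open>i\<close> and so disappears together with that color.\<close>
  have "set (arcs_within cs fs ?A') \<subseteq> ?E - (?I u \<union> ?I v)"
    using uv by (auto simp: set_arcs_within)
  then have "card (set (arcs_within cs fs ?A')) \<le> card (?E - (?I u \<union> ?I v))"
    by (intro card_mono) auto
  also have "\<dots> = card ?E - card (?I u \<union> ?I v)"
    by (intro card_Diff_subset) auto
  finally have "card (set (arcs_within cs fs ?A')) \<le> card ?E - card (?I u \<union> ?I v)" .
  moreover have "card (?I u \<union> ?I v) \<le> card ?E"
    by (intro card_mono) auto
  ultimately show ?thesis
    using I by (simp add: distinct_card distinct_arcs_within)
qed

text \<open>The strict inequality makes the invariant fail for the empty list, so preserving it
  keeps a color available.\<close>

definition sparse :: "nat list \<Rightarrow> bool" where
  "sparse A \<longleftrightarrow> distinct A \<and> length (arcs_within cs fs A) < (length A)\<^sup>2"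

lemma shrink_crowded:
  assumes "sparse A" "i \<in> set A" "crowded cs fs A i"
  shows "sparse (shrink cs fs A)" "set (shrink cs fs A) \<subseteq> set A"
    "length (shrink cs fs A) + 1 = length A"
proof -
  define j where "j = first (filter (crowded cs fs A) A)"
  have ne: "filter (crowded cs fs A) A \<noteq> []"
    using assms by (auto simp: filter_empty_conv)
  then have j: "j \<in> set A" "crowded cs fs A j"
    using first_in_set[OF ne] by (auto simp: j_def)
  have eq: "shrink cs fs A = filter (\<lambda>i. i \<noteq> j) A"
    using ne by (simp add: shrink_def j_def)
  have "distinct A" using assms by (simp add: sparse_def)
  then have "filter (\<lambda>i. i \<noteq> j) A = remove1 j A"
    by (simp add: distinct_remove1_removeAll removeAll_filter_not_eq eq_commute)
  then show len: "length (shrink cs fs A) + 1 = length A"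
    using j(1) length_pos_if_in_set[OF j(1)] by (simp add: eq length_remove1)
  show "set (shrink cs fs A) \<subseteq> set A" by (simp add: eq)
  \<comment> \<open>The drop of the square is exactly the number of arcs that
    \<open>arcs_within_remove_crowded\<close> guarantees to be lost.\<close>
  have "(length A)\<^sup>2 = (length (shrink cs fs A))\<^sup>2 + 2 * length A - 1"
    using len[symmetric] by (simp add: power2_eq_square)
  then show "sparse (shrink cs fs A)"
    using arcs_within_remove_crowded[OF j(2)] assms(1) unfolding eq sparse_def by auto
qed

text \<open>A round either removes a color or has reached a fixed point, where no color is crowded.
  If every round removed one, then as many rounds as colors would lead to the empty list, which is
  not \<open>sparse\<close>; this is how \<open>free_colors\<close> excludes the last
  disjunct.\<close>

lemma fold_shrink:
  assumes "sparse A"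
  shows "sparse (fold (\<lambda>_. shrink cs fs) xs A) \<and> set (fold (\<lambda>_. shrink cs fs) xs A) \<subseteq> set A \<and>
    ((\<forall>i\<in>set (fold (\<lambda>_. shrink cs fs) xs A). \<not> crowded cs fs (fold (\<lambda>_. shrink cs fs) xs A) i) \<or>
     length (fold (\<lambda>_. shrink cs fs) xs A) + length xs \<le> length A)"
  using assms
proof (induction xs arbitrary: A)
  case (Cons x xs)
  show ?case
  proof (cases "\<exists>i\<in>set A. crowded cs fs A i")
    case True
    then obtain i where i: "i \<in> set A" "crowded cs fs A i" by blast
    note sh = shrink_crowded[OF Cons.prems i]
    define B where "B = fold (\<lambda>_. shrink cs fs) xs (shrink cs fs A)"
    have "fold (\<lambda>_. shrink cs fs) (x # xs) A = B" by (simp add: B_def)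
    with Cons.IH[OF sh(1), folded B_def] sh(2,3) show ?thesis by auto
  next
    case False
    then have eq: "shrink cs fs A = A" by (auto simp: shrink_def filter_empty_conv)
    then have "fold (\<lambda>_. shrink cs fs) xs A = A" by (induction xs) simp_all
    with eq False Cons.prems show ?thesis by simp
  qed
qed simp

lemma free_colors:
  assumes "sparse K"
  shows "distinct (free_colors cs fs K)" "set (free_colors cs fs K) \<subseteq> set K" "free_colors cs fs K \<noteq> []"
    "i \<in> set (free_colors cs fs K) \<Longrightarrow> \<not> crowded cs fs (free_colors cs fs K) i"
proof -
  let ?A = "free_colors cs fs K"
  note * = fold_shrink[OF assms, of K, folded free_colors_def]
  then show "distinct ?A" "set ?A \<subseteq> set K" by (simp_all add: sparse_def)
  from * show ne: "?A \<noteq> []" by (auto simp: sparse_def)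
  from * ne show "i \<in> set ?A \<Longrightarrow> \<not> crowded cs fs ?A i" by auto
qed

section \<open>The greedy phase\<close>

definition greedy_inv :: "nat list \<Rightarrow> ('a \<times> nat) list \<Rightarrow> bool" where
  "greedy_inv A R \<longleftrightarrow> distinct (map fst R) \<and>
    (\<forall>v\<in>S. c v \<notin> set A \<or> high cs fs A v \<longrightarrow> v \<in> fst ` set R) \<and>
    (\<forall>(v, i)\<in>set R. if v \<in> S \<and> c v \<notin> set A then i = c v else i \<in> set A) \<and>
    (\<forall>(u, v)\<in>set (arcs_within cs fs A). \<forall>i. \<not> ((u, i) \<in> set R \<and> (v, i) \<in> set R))"

text \<open>If an arc within the classes of \<open>A\<close> has both ends in the start list, then
  both are high. Equal colors would thus make their class crowded.\<close>

lemma greedy_inv_init: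
  assumes "\<And>i. i \<in> set A \<Longrightarrow> \<not> crowded cs fs A i"
  shows "greedy_inv A (filter (\<lambda>p. \<not> (\<exists>j\<in>set A. j = snd p) \<or> high cs fs A (fst p)) cs)"
    (is "greedy_inv A ?R")
proof -
  have "inj_on fst (set cs)" by (auto simp: set_cs inj_on_def)
  then have "distinct (map fst cs)" by (simp add: distinct_map distinct_cs)
  then have "distinct (map fst ?R)" by (rule distinct_map_filter)
  moreover have R: "set ?R = (\<lambda>v. (v, c v)) ` {v \<in> S. c v \<notin> set A \<or> high cs fs A v}"
    by (auto simp: set_cs)
  moreover have "\<not> ((u, i) \<in> set ?R \<and> (v, i) \<in> set ?R)" if "(u, v) \<in> set (arcs_within cs fs A)" for u v i
    unfolding R using assms[of "c u"] that loopless[of u v]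
    by (auto simp: crowded_iff set_arcs_within)
  ultimately show ?thesis
    unfolding greedy_inv_def R by (intro conjI) (auto simp: image_image)
qed

text \<open>Pigeonhole: if all colors of \<open>A\<close> were blocked at \<open>v\<close>, each
  would occur at the other end of an arc at \<open>v\<close>, so \<open>v\<close> would have at
  least |A| such arcs. But by the second clause of \<open>greedy_inv\<close> high vertices of
  \<open>S\<close> are already colored.\<close>

lemma unblocked_color_exists:
  assumes A: "distinct A" "A \<noteq> []" and R: "greedy_inv A R" and v: "v \<notin> fst ` set R"
  shows "\<exists>i\<in>set A. \<not> blocked (arcs_within cs fs A) R v i"
proof (rule ccontr)
  let ?I = "{e \<in> set (arcs_within cs fs A). fst e = v \<or> snd e = v}"
  \<comment> \<open>The color of the end of \<open>e\<close> other than \<open>v\<close>; it maps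
    the arcs at \<open>v\<close> onto a superset of \<open>A\<close>.\<close>
  let ?color = "\<lambda>e. the (map_of R (if fst e = v then snd e else fst e))"
  assume *: "\<not> ?thesis"
  have "set A \<subseteq> ?color ` ?I"
  proof
    fix i
    assume "i \<in> set A"
    with * have "blocked (arcs_within cs fs A) R v i" by blast
    then obtain e w where e: "e \<in> set (arcs_within cs fs A)" and w: "(w, i) \<in> set R"
      and ev: "fst e = v \<and> snd e = w \<or> snd e = v \<and> fst e = w"
      unfolding blocked_def by force
    have "map_of R w = Some i" using R w by (simp add: greedy_inv_def)
    moreover have "w \<noteq> v" using v w by force
    ultimately have "?color e = i" using ev by auto
    with e ev show "i \<in> ?color ` ?I" by blast
  qed
  then have "card (set A) \<le> card (?color ` ?I)" by (intro card_mono) auto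
  also have "\<dots> \<le> card ?I" by (intro card_image_le) auto
  finally have "high cs fs A v" using A by (simp add: high_iff distinct_card)
  \<comment> \<open>The invariant speaks of high vertices in \<open>S\<close> only. As
    \<open>A\<close> is nonempty, a high vertex has an incident arc of F and therefore lies in
    \<open>S\<close>.\<close>
  moreover from this have "?I \<noteq> {}"
    using A(2) unfolding high_iff by (metis card.empty le_zero_eq length_0_conv)
  then have "v \<in> S" by (auto simp: set_arcs_within dest: ends)
  ultimately show False using R v by (auto simp: greedy_inv_def)
qed

lemma greedy_inv_step:
  assumes A: "distinct A" "A \<noteq> []" and R: "greedy_inv A R"
  shows "greedy_inv A (greedy_step (arcs_within cs fs A) A v R)"
proof (cases "v \<in> fst ` set R")
  case True
  then show ?thesis using R by (auto simp: greedy_step_def)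
next
  case False
  define i where "i = first (filter (\<lambda>i. \<not> blocked (arcs_within cs fs A) R v i) A)"
  have "filter (\<lambda>i. \<not> blocked (arcs_within cs fs A) R v i) A \<noteq> []"
    using unblocked_color_exists[OF A R False] by (auto simp: filter_empty_conv)
  then have i: "i \<in> set A" "\<not> blocked (arcs_within cs fs A) R v i"
    using first_in_set unfolding i_def by fastforce+
  have eq: "greedy_step (arcs_within cs fs A) A v R = (v, i) # R"
    using False by (force simp: greedy_step_def i_def)
  \<comment> \<open>Vertices in classes outside \<open>A\<close> are colored from the start, so the
    new entry only has to use a color of \<open>A\<close>.\<close>
  have "\<not> (v \<in> S \<and> c v \<notin> set A)" using False R by (auto simp: greedy_inv_def)
  moreover have "\<not> ((u, j) \<in> set ((v, i) # R) \<and> (w, j) \<in> set ((v, i) # R))"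
    if e: "(u, w) \<in> set (arcs_within cs fs A)" for u w j
  proof -
    have "u \<noteq> w" using e loopless by (auto simp: set_arcs_within)
    moreover have "\<not> ((u, j) \<in> set R \<and> (w, j) \<in> set R)" using R e by (auto simp: greedy_inv_def)
    moreover have "(w, i) \<notin> set R" if "u = v" using i(2) e that by (force simp: blocked_def)
    moreover have "(u, i) \<notin> set R" if "w = v" using i(2) e that by (force simp: blocked_def)
    ultimately show ?thesis by auto
  qed
  moreover have "distinct (map fst ((v, i) # R))" using R False by (simp add: greedy_inv_def)
  moreover have "\<forall>v\<in>S. c v \<notin> set A \<or> high cs fs A v \<longrightarrow> v \<in> fst ` set R"
    "\<forall>(v, i)\<in>set R. if v \<in> S \<and> c v \<notin> set A then i = c v else i \<in> set A"
    using R by (simp_all add: greedy_inv_def)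
  ultimately show ?thesis
    using i(1) unfolding eq greedy_inv_def by (intro conjI) auto
qed

lemma greedy_inv_fold:
  assumes "distinct A" "A \<noteq> []" "greedy_inv A R"
  shows "greedy_inv A (fold (greedy_step (arcs_within cs fs A) A) vs R)"
  using assms(3) by (induction vs arbitrary: R) (simp_all add: greedy_inv_step assms(1,2))

lemma dom_fold_greedy_step: "fst ` set (fold (greedy_step es A) vs R) = fst ` set R \<union> set vs"
proof (induction vs arbitrary: R)
  case (Cons v vs)
  have "fst ` set (greedy_step es A v R) = insert v (fst ` set R)"
    by (auto simp: greedy_step_def)
  with Cons show ?case by simp
qed simp

text \<open>Collects what acyclicity of the new classes will rest on: colors in \<open>A\<close>
  carry no monochromatic arc of F, and a vertex with any other color lies in \<open>S\<close> and
  kept its old color.\<close>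

lemma recolor_free_classes:
  assumes "1 \<le> k" "length fs \<le> k\<^sup>2 - 1" "S \<subseteq> set vs"
  obtains A where "A \<subseteq> {..<k}" "distinct (map fst (recolor k vs fs cs))"
    "fst ` set (recolor k vs fs cs) = set vs"
    "\<And>v i. (v, i) \<in> set (recolor k vs fs cs) \<Longrightarrow> i \<in> A \<or> v \<in> S \<and> i = c v"
    "\<And>u v i. (u, v) \<in> set fs \<Longrightarrow> (u, i) \<in> set (recolor k vs fs cs) \<Longrightarrow>
      (v, i) \<in> set (recolor k vs fs cs) \<Longrightarrow> i \<notin> A"
proof -
  define K where "K = palette k fs"
  define A where "A = free_colors cs fs K"
  define R where "R = recolor k vs fs cs"
  note palette_eq[OF assms(1), of fs, folded K_def]
  then have K: "distinct K" "set K \<subseteq> {..<k}" "length K = min k (Suc (length fs))" by auto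
  have "length fs < k\<^sup>2"
  proof -
    have "0 < k\<^sup>2" using assms(1) by simp
    with assms(2) show ?thesis by linarith
  qed
  \<comment> \<open>This case covers a capped palette: |F| + 1 colors are sparse whatever the size
    of \<open>k\<close>.\<close>
  moreover have "length fs < (Suc (length fs))\<^sup>2" by (simp add: power2_eq_square)
  ultimately have "length fs < (length K)\<^sup>2" by (simp add: K(3) min_def)
  moreover have "length (arcs_within cs fs K) \<le> length fs" by (simp add: arcs_within_def)
  ultimately have "sparse K" using K by (simp add: sparse_def)
  note A = free_colors[OF this, folded A_def]
  have "greedy_inv A R"
    unfolding R_def recolor_def greedy_def K_def[symmetric] A_def[symmetric]
    by (intro greedy_inv_fold greedy_inv_init A)
  then have inv: "distinct (map fst R)"
    "\<And>v i. (v, i) \<in> set R \<Longrightarrow> if v \<in> S \<and> c v \<notin> set A then i = c v else i \<in> set A"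
    "\<And>u v i. (u, v) \<in> set (arcs_within cs fs A) \<Longrightarrow> (u, i) \<in> set R \<Longrightarrow> (v, i) \<notin> set R"
    unfolding greedy_inv_def by blast+
  have "fst ` set cs \<subseteq> set vs" using assms(3) by (auto simp: set_cs)
  then have dom: "fst ` set R = set vs"
    unfolding R_def recolor_def greedy_def by (subst dom_fold_greedy_step) auto
  show thesis
  proof (rule that[of "set A", folded R_def])
    show "set A \<subseteq> {..<k}" using A K by auto
    show "i \<in> set A \<or> v \<in> S \<and> i = c v" if "(v, i) \<in> set R" for v i
      using inv(2)[OF that] by (auto split: if_splits)
    show "i \<notin> set A" if e: "(u, v) \<in> set fs" and i: "(u, i) \<in> set R" "(v, i) \<in> set R" for u v i
    proof
      assume "i \<in> set A"
      \<comment> \<open>A vertex of \<open>S\<close> with new color in \<open>A\<close> also had its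
        old color in \<open>A\<close>, so the arc is among those the greedy phase respected.\<close>
      with inv(2)[OF i(1)] inv(2)[OF i(2)] ends[OF e] e
      have "(u, v) \<in> set (arcs_within cs fs A)"
        by (auto simp: set_arcs_within split: if_splits)
      with inv(3) i show False by blast
    qed
  qed (fact inv(1) dom)+
qed

end

section \<open>Polynomial-time tree functions\<close>

lemma poly_nat_mono: "m \<le> n \<Longrightarrow> poly (p :: nat poly) m \<le> poly p n"
  by (induction p) (auto intro!: add_mono mult_mono)

lemma nodes_pos: "0 < nodes x"
  by (cases x) simp_all

lemma nodes_left_le: "nodes (left x) \<le> nodes x"
  by (cases x) simp_all

lemma nodes_right_le: "nodes (right x) \<le> nodes x"
  by (cases x) simp_all

text \<open>Upper bounds can be rounded up at every step, which exact running times do not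
  permit.\<close>

definition runs :: "com \<Rightarrow> state \<Rightarrow> nat \<Rightarrow> state \<Rightarrow> bool" where
  "runs c s T s' \<longleftrightarrow> (\<exists>t\<le>T. exec c s t s')"

lemma runs_mono: "runs c s T s' \<Longrightarrow> T \<le> U \<Longrightarrow> runs c s U s'"
  unfolding runs_def by (meson le_trans)

lemma runs_Assign: "runs (Assign x e) s (1 + cost e s) (s(x := eval e s))"
  unfolding runs_def by (blast intro: exec.Assign)

lemma runs_Seq: "runs c s T s' \<Longrightarrow> runs d s' U s'' \<Longrightarrow> runs (Seq c d) s (1 + T + U) s''"
  unfolding runs_def by (meson add_le_mono exec.Seq order_refl)

lemma runs_CondTrue:
  "eval e s \<noteq> Leaf \<Longrightarrow> runs c s T s' \<Longrightarrow> runs (Cond e c d) s (1 + cost e s + T) s'"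
  unfolding runs_def by (meson add_le_mono exec.CondTrue order_refl)

lemma runs_CondFalse:
  "eval e s = Leaf \<Longrightarrow> runs d s T s' \<Longrightarrow> runs (Cond e c d) s (1 + cost e s + T) s'"
  unfolding runs_def by (meson add_le_mono exec.CondFalse order_refl)

lemma runs_WhileFalse: "eval e s = Leaf \<Longrightarrow> runs (While e c) s (1 + cost e s) s"
  unfolding runs_def by (blast intro: exec.WhileFalse)

lemma runs_WhileTrue:
  "eval e s \<noteq> Leaf \<Longrightarrow> runs c s T s' \<Longrightarrow> runs (While e c) s' U s'' \<Longrightarrow>
    runs (While e c) s (1 + cost e s + T + U) s''"
  unfolding runs_def by (meson add_le_mono exec.WhileTrue order_refl)

text \<open>
  Variables from \<open>N\<close> on are left untouched, so that a calling program can store its data there.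
\<close>

definition implements :: "com \<Rightarrow> nat \<Rightarrow> nat poly \<Rightarrow> (tree \<Rightarrow> tree) \<Rightarrow> bool" where
  "implements c N p f \<longleftrightarrow> 0 < N \<and> (\<forall>x. nodes (f x) \<le> poly p (nodes x)) \<and>
     (\<forall>s. \<exists>s'. runs c s (poly p (nodes (s 0))) s' \<and> s' 0 = f (s 0) \<and> (\<forall>v\<ge>N. s' v = s v))"

definition ptime :: "(tree \<Rightarrow> tree) \<Rightarrow> bool" where
  "ptime f \<longleftrightarrow> (\<exists>c N p. implements c N p f)"

lemma implements_mono: "implements c N p f \<Longrightarrow> N \<le> M \<Longrightarrow> implements c M p f"
  unfolding implements_def by (meson less_le_trans le_trans)

lemma implements_nodes: "implements c N p f \<Longrightarrow> nodes (f x) \<le> poly p (nodes x)"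
  unfolding implements_def by blast

lemma implements_runs:
  assumes "implements c N p f"
  obtains s' where "runs c s (poly p (nodes (s 0))) s'" "s' 0 = f (s 0)" "\<And>v. N \<le> v \<Longrightarrow> s' v = s v"
  using assms unfolding implements_def by blast

lemma ptimeI:
  assumes "0 < N"
    and "\<And>x. nodes (f x) \<le> poly p (nodes x)"
    and "\<And>s. \<exists>s' T. runs c s T s' \<and> T \<le> poly p (nodes (s 0)) \<and> s' 0 = f (s 0) \<and> (\<forall>v\<ge>N. s' v = s v)"
  shows "ptime f"
  unfolding ptime_def implements_def using assms by (meson runs_mono)

lemma ptime_assign:
  assumes "\<And>s. eval e s = f (s 0)"
    and "\<And>s. 1 + cost e s \<le> poly p (nodes (s 0))"
    and "\<And>x. nodes (f x) \<le> poly p (nodes x)"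
  shows "ptime f"
proof (rule ptimeI[where N = 1 and c = "Assign 0 e" and p = p])
  show "\<exists>s' T. runs (Assign 0 e) s T s' \<and> T \<le> poly p (nodes (s 0)) \<and> s' 0 = f (s 0) \<and>
      (\<forall>v\<ge>1. s' v = s v)" for s
    using runs_Assign[of 0 e s] assms(1)[of s] assms(2)[of s] by fastforce
qed (use assms(3) in auto)

lemma ptime_id: "ptime (\<lambda>x. x)"
  by (rule ptime_assign[where e = "EVar 0" and p = "[:1, 1:]"]) auto

lemma ptime_Leaf: "ptime (\<lambda>x. Leaf)"
  by (rule ptime_assign[where e = ELeaf and p = "[:2:]"]) auto

text \<open>The output size bound of \<open>g\<close> limits the input of \<open>f\<close>, whence
  the composed polynomial. The second program may start on leftover work variables, since
  \<open>implements\<close> quantifies over all initial states.\<close>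

lemma ptime_comp:
  assumes "ptime f" "ptime g"
  shows "ptime (\<lambda>x. f (g x))"
proof -
  from assms obtain c N p d M q where "implements c N p f" "implements d M q g"
    unfolding ptime_def by blast
  then have f: "implements c (max N M) p f" and g: "implements d (max N M) q g"
    by (auto elim: implements_mono)
  show ?thesis
  proof (rule ptimeI[where c = "Seq d c" and N = "max N M" and p = "1 + q + pcompose p q"])
    show "0 < max N M" using f unfolding implements_def by blast
    have pq: "poly p (nodes (g x)) \<le> poly p (poly q (nodes x))" for x
      by (intro poly_nat_mono implements_nodes[OF g])
    show "nodes (f (g x)) \<le> poly (1 + q + pcompose p q) (nodes x)" for x
      using implements_nodes[OF f, of "g x"] pq[of x] by (simp add: poly_pcompose)
    fix s :: state
    obtain s1 where s1: "runs d s (poly q (nodes (s 0))) s1" "s1 0 = g (s 0)"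
      "\<And>v. max N M \<le> v \<Longrightarrow> s1 v = s v" using implements_runs[OF g, of s] by blast
    obtain s2 where s2: "runs c s1 (poly p (nodes (s1 0))) s2" "s2 0 = f (s1 0)"
      "\<And>v. max N M \<le> v \<Longrightarrow> s2 v = s1 v" using implements_runs[OF f, of s1] by blast
    show "\<exists>s' T. runs (Seq d c) s T s' \<and> T \<le> poly (1 + q + pcompose p q) (nodes (s 0)) \<and>
        s' 0 = f (g (s 0)) \<and> (\<forall>v\<ge>max N M. s' v = s v)"
      using runs_Seq[OF s1(1) s2(1)] s1 s2 pq[of "s 0"]
      by (intro exI[of _ s2] exI conjI) (auto simp: poly_pcompose)
  qed
qed

lemma ptime_left:
  assumes "ptime f"
  shows "ptime (\<lambda>x. left (f x))"
proof -
  have "ptime left"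
    by (rule ptime_assign[where e = "ELeft (EVar 0)" and p = "[:1, 2:]"])
      (auto intro: le_trans[OF nodes_left_le])
  from ptime_comp[OF this assms] show ?thesis .
qed

lemma ptime_right:
  assumes "ptime f"
  shows "ptime (\<lambda>x. right (f x))"
proof -
  have "ptime right"
    by (rule ptime_assign[where e = "ERight (EVar 0)" and p = "[:1, 2:]"])
      (auto intro: le_trans[OF nodes_right_le])
  from ptime_comp[OF this assms] show ?thesis .
qed

lemma ptime_Node:
  assumes "ptime f" "ptime g"
  shows "ptime (\<lambda>x. Node (f x) (g x))"
proof -
  from assms obtain c N' p d M' q where "implements c N' p f" "implements d M' q g"
    unfolding ptime_def by blast
  then obtain N where f: "implements c N p f" and g: "implements d N q g"
    by (metis implements_mono max.cobounded1 max.cobounded2)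
  have N: "0 < N" using f unfolding implements_def by blast
  \<comment> \<open>The input is saved in variable \<open>N\<close> and the first result in
    \<open>Suc N\<close>; both subprograms leave these alone.\<close>
  let ?c = "Seq (Assign N (EVar 0)) (Seq c (Seq (Assign (Suc N) (EVar 0))
    (Seq (Assign 0 (EVar N)) (Seq d (Assign 0 (ENode (EVar (Suc N)) (EVar 0)))))))"
  let ?p = "[:20, 2:] + of_nat 4 * p + of_nat 4 * q"
  show ?thesis
  proof (rule ptimeI[where c = ?c and N = "Suc (Suc N)" and p = ?p])
    show "nodes (Node (f x) (g x)) \<le> poly ?p (nodes x)" for x
      using implements_nodes[OF f, of x] implements_nodes[OF g, of x] by simp
    fix s :: state
    let ?s1 = "s(N := s 0)"
    obtain s2 where s2: "runs c ?s1 (poly p (nodes (?s1 0))) s2" "s2 0 = f (?s1 0)"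
      "\<And>v. N \<le> v \<Longrightarrow> s2 v = ?s1 v" using implements_runs[OF f] by blast
    let ?s4 = "s2(Suc N := s2 0, 0 := s2 N)"
    obtain s5 where s5: "runs d ?s4 (poly q (nodes (?s4 0))) s5" "s5 0 = g (?s4 0)"
      "\<And>v. N \<le> v \<Longrightarrow> s5 v = ?s4 v" using implements_runs[OF g] by blast
    let ?s6 = "s5(0 := Node (s5 (Suc N)) (s5 0))"
    have a1: "runs (Assign N (EVar 0)) s (1 + nodes (s 0)) ?s1"
      using runs_Assign[of N "EVar 0" s] by simp
    have a3: "runs (Assign (Suc N) (EVar 0)) s2 (1 + nodes (s2 0)) (s2(Suc N := s2 0))"
      using runs_Assign[of "Suc N" "EVar 0" s2] by simp
    have a4: "runs (Assign 0 (EVar N)) (s2(Suc N := s2 0)) (1 + nodes (s2 N)) ?s4"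
      using runs_Assign[of 0 "EVar N" "s2(Suc N := s2 0)"] by simp
    have a6: "runs (Assign 0 (ENode (EVar (Suc N)) (EVar 0))) s5
        (2 + 2 * nodes (s5 (Suc N)) + 2 * nodes (s5 0)) ?s6"
      using runs_mono[OF runs_Assign[of 0 "ENode (EVar (Suc N)) (EVar 0)" s5]] by simp
    note run = runs_Seq[OF a1 runs_Seq[OF s2(1) runs_Seq[OF a3 runs_Seq[OF a4 runs_Seq[OF s5(1) a6]]]]]
    have "\<exists>T. runs ?c s T ?s6 \<and> T \<le> poly ?p (nodes (s 0))"
      by (intro exI conjI, rule run)
        (use implements_nodes[OF f, of "s 0"] implements_nodes[OF g, of "s 0"] s2(2,3) s5(2,3) N in auto)
    moreover have "?s6 0 = Node (f (s 0)) (g (s 0))" "\<forall>v\<ge>Suc (Suc N). ?s6 v = s v"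
      using s2(2,3) s5(2,3) N by auto
    ultimately show "\<exists>s' T. runs ?c s T s' \<and> T \<le> poly ?p (nodes (s 0)) \<and>
        s' 0 = Node (f (s 0)) (g (s 0)) \<and> (\<forall>v\<ge>Suc (Suc N). s' v = s v)" by blast
  qed simp
qed

section \<open>Decidable predicates and branching\<close>

definition of_bool_tree :: "bool \<Rightarrow> tree" where
  "of_bool_tree b = (if b then Node Leaf Leaf else Leaf)"

definition pdec :: "(tree \<Rightarrow> bool) \<Rightarrow> bool" where
  "pdec P \<longleftrightarrow> ptime (\<lambda>x. of_bool_tree (P x))"

lemma pdec_eq:
  assumes "ptime f" "ptime g"
  shows "pdec (\<lambda>x. f x = g x)"
proof -
  have "ptime (\<lambda>z. of_bool_tree (left z = right z))"
  proof (rule ptime_assign[where e = "EEq (ELeft (EVar 0)) (ERight (EVar 0))" and p = "[:4, 4:]"])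
    show "1 + cost (EEq (ELeft (EVar 0)) (ERight (EVar 0))) s \<le> poly [:4, 4:] (nodes (s 0))" for s
      using nodes_left_le[of "s 0"] nodes_right_le[of "s 0"] by auto
  qed (auto simp: of_bool_tree_def)
  from ptime_comp[OF this ptime_Node[OF assms]] show ?thesis
    by (simp add: pdec_def)
qed

lemma ptime_if:
  assumes "pdec P" "ptime f" "ptime g"
  shows "ptime (\<lambda>x. if P x then f x else g x)"
proof -
  from assms obtain b B r c N' p d M' q where
    "implements b B r (\<lambda>x. of_bool_tree (P x))" "implements c N' p f" "implements d M' q g"
    unfolding ptime_def pdec_def by blast
  then obtain N where b: "implements b N r (\<lambda>x. of_bool_tree (P x))"
    and f: "implements c N p f" and g: "implements d N q g"
    by (meson implements_mono max.cobounded1 max.cobounded2 le_trans)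
  have N: "0 < N" using f unfolding implements_def by blast
  let ?r = "Assign 0 (EVar N)"
  let ?c = "Seq (Assign N (EVar 0)) (Seq b (Cond (EVar 0) (Seq ?r c) (Seq ?r d)))"
  let ?p = "[:20, 2:] + of_nat 2 * r + p + q"
  show ?thesis
  proof (rule ptimeI[where c = ?c and N = "Suc N" and p = ?p])
    show "nodes (if P x then f x else g x) \<le> poly ?p (nodes x)" for x
      using implements_nodes[OF f, of x] implements_nodes[OF g, of x] by simp
    fix s :: state
    let ?s1 = "s(N := s 0)"
    obtain s2 where s2: "runs b ?s1 (poly r (nodes (?s1 0))) s2" "s2 0 = of_bool_tree (P (?s1 0))"
      "\<And>v. N \<le> v \<Longrightarrow> s2 v = ?s1 v" using implements_runs[OF b] by blast
    have 0: "s2 0 = of_bool_tree (P (s 0))" "s2 N = s 0" using s2 N by simp_all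
    have r0: "nodes (s2 0) \<le> poly r (nodes (s 0))" using implements_nodes[OF b] 0 by simp
    have r: "runs ?r s2 (1 + nodes (s 0)) (s2(0 := s 0))"
      using runs_Assign[of 0 "EVar N" s2] 0 by simp
    let ?h = "if P (s 0) then f else g"
    \<comment> \<open>The test has overwritten variable 0, so each branch first restores the input.
      Charging the sum of both branch bounds gives one estimate for the two cases.\<close>
    obtain s3 where s3: "runs (Cond (EVar 0) (Seq ?r c) (Seq ?r d)) s2
        (1 + cost (EVar 0) s2 + (1 + (1 + nodes (s 0)) + (poly p (nodes (s 0)) + poly q (nodes (s 0))))) s3"
      "s3 0 = ?h (s 0)" "\<And>v. N \<le> v \<Longrightarrow> s3 v = s2 v"
    proof (cases "P (s 0)")
      case True
      obtain s3 where s3: "runs c (s2(0 := s 0)) (poly p (nodes (s 0))) s3" "s3 0 = f (s 0)"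
        "\<And>v. N \<le> v \<Longrightarrow> s3 v = (s2(0 := s 0)) v"
        using implements_runs[OF f, of "s2(0 := s 0)"] by auto
      from runs_CondTrue[OF _ runs_Seq[OF r s3(1)], of "EVar 0" "Seq ?r d"] True 0
      have "runs (Cond (EVar 0) (Seq ?r c) (Seq ?r d)) s2
        (1 + cost (EVar 0) s2 + (1 + (1 + nodes (s 0)) + poly p (nodes (s 0)))) s3"
        by (simp add: of_bool_tree_def)
      with s3 True N show thesis by (intro that[of s3]) (auto elim: runs_mono)
    next
      case False
      obtain s3 where s3: "runs d (s2(0 := s 0)) (poly q (nodes (s 0))) s3" "s3 0 = g (s 0)"
        "\<And>v. N \<le> v \<Longrightarrow> s3 v = (s2(0 := s 0)) v"
        using implements_runs[OF g, of "s2(0 := s 0)"] by auto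
      from runs_CondFalse[OF _ runs_Seq[OF r s3(1)], of "EVar 0" "Seq ?r c"] False 0
      have "runs (Cond (EVar 0) (Seq ?r c) (Seq ?r d)) s2
        (1 + cost (EVar 0) s2 + (1 + (1 + nodes (s 0)) + poly q (nodes (s 0)))) s3"
        by (simp add: of_bool_tree_def)
      with s3 False N show thesis by (intro that[of s3]) (auto elim: runs_mono)
    qed
    have "runs (Assign N (EVar 0)) s (1 + nodes (s 0)) ?s1"
      using runs_Assign[of N "EVar 0" s] by simp
    from runs_Seq[OF this runs_Seq[OF s2(1) s3(1)]] s2(3) s3(2,3) N r0
    show "\<exists>s' T. runs ?c s T s' \<and> T \<le> poly ?p (nodes (s 0)) \<and>
        s' 0 = (if P (s 0) then f (s 0) else g (s 0)) \<and> (\<forall>v\<ge>Suc N. s' v = s v)"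
      by (intro exI[of _ s3] exI conjI) auto
  qed simp
qed

section \<open>Lists read off the right spine of an arbitrary tree, and loops over them\<close>

primrec items :: "tree \<Rightarrow> tree list" where
  "items Leaf = []"
| "items (Node a b) = a # items b"

lemma enc_list_simps [simp]:
  "enc_list f [] = Leaf" "enc_list f (x # xs) = Node (f x) (enc_list f xs)"
  by (simp_all add: enc_list_def)

lemma items_enc_list [simp]: "items (enc_list f xs) = map f xs"
  by (induction xs) simp_all

lemma enc_list_items [simp]: "enc_list (\<lambda>x. x) (items x) = x"
  by (induction x) simp_all

lemma enc_list_map: "enc_list f (map g xs) = enc_list (\<lambda>x. f (g x)) xs"
  by (induction xs) simp_all

lemma length_items_less: "length (items x) < nodes x"
  by (induction x) simp_all

lemma nodes_items_le: "a \<in> set (items x) \<Longrightarrow> nodes a \<le> nodes x"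
  by (induction x) auto

text \<open>Variables \<open>N\<close>, \<open>N + 1\<close>, \<open>N + 2\<close> hold the
  parameter, the remaining list and the accumulator; each round packs them into variable 0 for
  \<open>c\<close>. \<open>Q\<close> bounds the accumulator after every prefix and \<open>T\<close>
  one round; the extra \<open>T\<close> pays for the final test.\<close>

lemma runs_fold_loop:
  assumes h: "implements c N r (\<lambda>z. h (left z) (left (right z)) (right (right z)))"
    and s: "s N = x" "s (Suc N) = l" "s (Suc (Suc N)) = acc"
    and L: "nodes l \<le> L"
    and Q: "\<And>ys zs. items l = ys @ zs \<Longrightarrow> nodes (fold (h x) ys acc) \<le> Q"
    and T: "T = 30 + 10 * (nodes x + L + Q) + poly r (2 + nodes x + L + Q)"
  shows "\<exists>s'. runs (While (EVar (Suc N))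
      (Seq (Assign 0 (ENode (EVar N) (ENode (ELeft (EVar (Suc N))) (EVar (Suc (Suc N))))))
      (Seq c (Seq (Assign (Suc (Suc N)) (EVar 0)) (Assign (Suc N) (ERight (EVar (Suc N)))))))) s
      ((1 + length (items l)) * T) s' \<and> s' (Suc (Suc N)) = fold (h x) (items l) acc \<and>
      (\<forall>v\<ge>N + 3. s' v = s v)"
    (is "\<exists>s'. runs (While ?e ?b) _ _ _ \<and> _")
  using s L Q
proof (induction l arbitrary: s acc)
  case Leaf
  then have "runs (While ?e ?b) s ((1 + length (items Leaf)) * T) s"
    by (intro runs_mono[OF runs_WhileFalse]) (auto simp: T)
  with Leaf.prems show ?case by auto
next
  case (Node a l)
  have N: "0 < N" using h by (simp add: implements_def)
  let ?s1 = "s(0 := Node x (Node a acc))"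
  have acc: "nodes acc \<le> Q" using Node.prems(5)[of "[]"] by simp
  have acc': "nodes (h x a acc) \<le> Q" using Node.prems(5)[of "[a]"] by simp
  have L: "1 + nodes a + nodes l \<le> L" using Node.prems(4) by simp
  have a1: "runs (Assign 0 (ENode (EVar N) (ENode (ELeft (EVar (Suc N))) (EVar (Suc (Suc N)))))) s
      (10 + 3 * nodes x + 4 * L + 3 * Q) ?s1"
    using runs_mono[OF runs_Assign[of 0 "ENode (EVar N) (ENode (ELeft (EVar (Suc N))) (EVar (Suc (Suc N))))" s]]
      Node.prems(1-3) acc L by simp
  obtain s2 where s2: "runs c ?s1 (poly r (nodes (?s1 0))) s2" "s2 0 = h x a acc"
    "\<And>v. N \<le> v \<Longrightarrow> s2 v = ?s1 v" using implements_runs[OF h, of ?s1] by auto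
  have s2': "s2 N = x" "s2 (Suc N) = Node a l" "\<And>v. N + 3 \<le> v \<Longrightarrow> s2 v = s v"
    using Node.prems(1-3) s2(3) N by auto
  have "poly r (nodes (?s1 0)) \<le> poly r (2 + nodes x + L + Q)"
    using acc L by (intro poly_nat_mono) simp
  with s2(1) have a2: "runs c ?s1 (poly r (2 + nodes x + L + Q)) s2" by (rule runs_mono)
  have a3: "runs (Assign (Suc (Suc N)) (EVar 0)) s2 (1 + Q) (s2(Suc (Suc N) := h x a acc))"
    using runs_mono[OF runs_Assign[of "Suc (Suc N)" "EVar 0" s2]] s2(2) acc' by simp
  let ?s4 = "s2(Suc (Suc N) := h x a acc, Suc N := l)"
  have a4: "runs (Assign (Suc N) (ERight (EVar (Suc N)))) (s2(Suc (Suc N) := h x a acc)) (1 + 2 * L) ?s4"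
    using runs_mono[OF runs_Assign[of "Suc N" "ERight (EVar (Suc N))" "s2(Suc (Suc N) := h x a acc)"]]
      s2'(2) L by simp
  note body = runs_Seq[OF a1 runs_Seq[OF a2 runs_Seq[OF a3 a4]]]
  have "\<exists>s'. runs (While ?e ?b) ?s4 ((1 + length (items l)) * T) s' \<and>
      s' (Suc (Suc N)) = fold (h x) (items l) (h x a acc) \<and> (\<forall>v\<ge>N + 3. s' v = ?s4 v)"
  proof (rule Node.IH(2))
    show "nodes (fold (h x) ys (h x a acc)) \<le> Q" if "items l = ys @ zs" for ys zs
      using Node.prems(5)[of "a # ys" zs] that by simp
  qed (use s2' L in auto)
  then obtain s' where s': "runs (While ?e ?b) ?s4 ((1 + length (items l)) * T) s'"
      "s' (Suc (Suc N)) = fold (h x) (items l) (h x a acc)" "\<And>v. v\<ge>N + 3 \<Longrightarrow> s' v = ?s4 v" by blast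
  have "runs (While ?e ?b) s ((1 + length (items (Node a l))) * T) s'"
    by (rule runs_mono[OF runs_WhileTrue[OF _ body s'(1)]]) (use Node.prems(2) L in \<open>auto simp: T\<close>)
  with s'(2,3) s2'(3) show ?case by (intro exI[of _ s']) auto
qed

text \<open>Iterating a polynomial-time step may blow up exponentially, for example by repeated
  doubling. Hence a polynomial bound on all intermediate accumulators is demanded.\<close>

lemma ptime_fold_bounded:
  assumes "ptime (\<lambda>z. h (left z) (left (right z)) (right (right z)))" "ptime l" "ptime i"
    and Q: "\<And>x ys zs. items (l x) = ys @ zs \<Longrightarrow> nodes (fold (h x) ys (i x)) \<le> poly q (nodes x)"
  shows "ptime (\<lambda>x. fold (h x) (items (l x)) (i x))"
proof -
  from assms(1-3) obtain c N1 r d N2 p e N3 p' where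
    "implements c N1 r (\<lambda>z. h (left z) (left (right z)) (right (right z)))"
    "implements d N2 p l" "implements e N3 p' i"
    unfolding ptime_def by blast
  then obtain N where h: "implements c N r (\<lambda>z. h (left z) (left (right z)) (right (right z)))"
    and l: "implements d N p l" and i: "implements e N p' i"
    by (meson implements_mono max.cobounded1 max.cobounded2 le_trans)
  have N: "0 < N" using h by (simp add: implements_def)
  let ?loop = "While (EVar (Suc N))
      (Seq (Assign 0 (ENode (EVar N) (ENode (ELeft (EVar (Suc N))) (EVar (Suc (Suc N))))))
      (Seq c (Seq (Assign (Suc (Suc N)) (EVar 0)) (Assign (Suc N) (ERight (EVar (Suc N)))))))"
  let ?c = "Seq (Assign N (EVar 0)) (Seq d (Seq (Assign (Suc N) (EVar 0)) (Seq (Assign 0 (EVar N))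
      (Seq e (Seq (Assign (Suc (Suc N)) (EVar 0)) (Seq ?loop (Assign 0 (EVar (Suc (Suc N))))))))))"
  let ?X = "[:0, 1:] :: nat poly"
  let ?T = "of_nat 30 + of_nat 10 * (?X + p + q) + pcompose r (of_nat 2 + ?X + p + q)"
  let ?p = "[:20, 2:] + of_nat 2 * p + of_nat 2 * p' + (1 + p) * ?T + of_nat 2 * q"
  show ?thesis
  proof (rule ptimeI[where c = ?c and N = "N + 3" and p = ?p])
    show "nodes (fold (h x) (items (l x)) (i x)) \<le> poly ?p (nodes x)" for x
      using Q[of x "items (l x)" "[]"] by simp
    fix s :: state
    let ?n = "nodes (s 0)"
    let ?s1 = "s(N := s 0)"
    have a1: "runs (Assign N (EVar 0)) s (1 + ?n) ?s1"
      using runs_Assign[of N "EVar 0" s] by simp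
    obtain s2 where s2: "runs d ?s1 (poly p ?n) s2" "s2 0 = l (s 0)"
      "\<And>v. N \<le> v \<Longrightarrow> s2 v = ?s1 v" using implements_runs[OF l, of ?s1] N by auto
    have l_le: "nodes (l (s 0)) \<le> poly p ?n" and i_le: "nodes (i (s 0)) \<le> poly p' ?n"
      using implements_nodes[OF l] implements_nodes[OF i] by blast+
    let ?s3 = "s2(Suc N := l (s 0))"
    have a3: "runs (Assign (Suc N) (EVar 0)) s2 (1 + poly p ?n) ?s3"
      using runs_mono[OF runs_Assign[of "Suc N" "EVar 0" s2]] s2(2) l_le by simp
    let ?s4 = "?s3(0 := s 0)"
    have a4: "runs (Assign 0 (EVar N)) ?s3 (1 + ?n) ?s4"
      using runs_Assign[of 0 "EVar N" ?s3] s2(3) by simp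
    obtain s5 where s5: "runs e ?s4 (poly p' ?n) s5" "s5 0 = i (s 0)"
      "\<And>v. N \<le> v \<Longrightarrow> s5 v = ?s4 v" using implements_runs[OF i, of ?s4] N by auto
    let ?s6 = "s5(Suc (Suc N) := i (s 0))"
    have a6: "runs (Assign (Suc (Suc N)) (EVar 0)) s5 (1 + poly p' ?n) ?s6"
      using runs_mono[OF runs_Assign[of "Suc (Suc N)" "EVar 0" s5]] s5(2) i_le by simp
    have s6: "?s6 N = s 0" "?s6 (Suc N) = l (s 0)" "?s6 (Suc (Suc N)) = i (s 0)"
      "\<And>v. N + 3 \<le> v \<Longrightarrow> ?s6 v = s v"
      using s2(3) s5(3) N by auto
    have "\<exists>s'. runs ?loop ?s6 ((1 + length (items (l (s 0)))) *
        (30 + 10 * (?n + poly p ?n + poly q ?n) + poly r (2 + ?n + poly p ?n + poly q ?n))) s' \<and>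
        s' (Suc (Suc N)) = fold (h (s 0)) (items (l (s 0))) (i (s 0)) \<and> (\<forall>v\<ge>N + 3. s' v = ?s6 v)"
      by (rule runs_fold_loop[where Q = "poly q ?n", OF h s6(1-3) l_le _ refl]) (rule Q)
    then obtain s7 where
      s7: "runs ?loop ?s6 ((1 + length (items (l (s 0)))) * (30 + 10 * (?n + poly p ?n + poly q ?n) +
          poly r (2 + ?n + poly p ?n + poly q ?n))) s7"
        "s7 (Suc (Suc N)) = fold (h (s 0)) (items (l (s 0))) (i (s 0))"
        "\<And>v. N + 3 \<le> v \<Longrightarrow> s7 v = ?s6 v"
      by blast
    have "(1 + length (items (l (s 0)))) * (30 + 10 * (?n + poly p ?n + poly q ?n) +
        poly r (2 + ?n + poly p ?n + poly q ?n)) \<le> (1 + poly p ?n) * poly ?T ?n"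
      using length_items_less[of "l (s 0)"] l_le by (intro mult_mono) (auto simp: poly_pcompose)
    with s7(1) have a7: "runs ?loop ?s6 ((1 + poly p ?n) * poly ?T ?n) s7" by (rule runs_mono)
    let ?res = "fold (h (s 0)) (items (l (s 0))) (i (s 0))"
    have "nodes ?res \<le> poly q ?n"
      using Q[of "s 0" "items (l (s 0))" "[]"] by simp
    then have a8: "runs (Assign 0 (EVar (Suc (Suc N)))) s7 (1 + poly q ?n) (s7(0 := ?res))"
      using runs_mono[OF runs_Assign[of 0 "EVar (Suc (Suc N))" s7]] s7(2) by simp
    note run = runs_Seq[OF a1 runs_Seq[OF s2(1) runs_Seq[OF a3 runs_Seq[OF a4 runs_Seq[OF s5(1)
      runs_Seq[OF a6 runs_Seq[OF a7 a8]]]]]]]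
    show "\<exists>s' T. runs ?c s T s' \<and> T \<le> poly ?p (nodes (s 0)) \<and>
        s' 0 = ?res \<and> (\<forall>v\<ge>N + 3. s' v = s v)"
      by (intro exI conjI, rule run) (use s7(3) s6(4) in auto)
  qed simp
qed

lemma nodes_fold_le:
  assumes "\<And>a acc. a \<in> set ys \<Longrightarrow> nodes (h a acc) \<le> nodes acc + b"
  shows "nodes (fold h ys acc) \<le> nodes acc + length ys * b"
  using assms
proof (induction ys arbitrary: acc)
  case (Cons y ys)
  have "nodes (fold h ys (h y acc)) \<le> nodes (h y acc) + length ys * b"
    using Cons by auto
  with Cons.prems[of y acc] show ?case by simp
qed simp

text \<open>If the increment per round does not depend on the accumulator, the total growth is at
  most the number of rounds times a common increment, which is polynomial.\<close>

lemma ptime_fold: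
  assumes h: "ptime (\<lambda>z. h (left z) (left (right z)) (right (right z)))"
    and l: "ptime l" and i: "ptime i"
    and b: "\<And>x a acc. nodes (h x a acc) \<le> nodes acc + poly q (nodes x + nodes a)"
  shows "ptime (\<lambda>x. fold (h x) (items (l x)) (i x))"
proof -
  from l i obtain p p' where p: "\<And>x. nodes (l x) \<le> poly p (nodes x)"
    and p': "\<And>x. nodes (i x) \<le> poly p' (nodes x)"
    unfolding ptime_def implements_def by metis
  let ?q = "p' + p * pcompose q ([:0, 1:] + p)"
  show ?thesis
  proof (rule ptime_fold_bounded[OF h l i, where q = ?q])
    fix x ys zs
    assume eq: "items (l x) = ys @ zs"
    let ?b = "poly q (nodes x + poly p (nodes x))"
    have "nodes (fold (h x) ys (i x)) \<le> nodes (i x) + length ys * ?b"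
    proof (rule nodes_fold_le)
      fix a acc
      assume "a \<in> set ys"
      then have "nodes a \<le> poly p (nodes x)"
        using nodes_items_le[of a "l x"] eq p[of x] by auto
      then have "poly q (nodes x + nodes a) \<le> ?b" by (intro poly_nat_mono) simp
      with b[of x a acc] show "nodes (h x a acc) \<le> nodes acc + ?b" by simp
    qed
    also have "\<dots> \<le> poly p' (nodes x) + poly p (nodes x) * ?b"
    proof (intro add_mono mult_mono)
      have "length ys \<le> length (items (l x))" using eq by simp
      then show "length ys \<le> poly p (nodes x)"
        using length_items_less[of "l x"] p[of x] by linarith
    qed (use p' in auto)
    finally show "nodes (fold (h x) ys (i x)) \<le> poly ?q (nodes x)"
      by (simp add: poly_pcompose)
  qed
qed

lemma pdec_conj:
  assumes "pdec P" "pdec Q"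
  shows "pdec (\<lambda>x. P x \<and> Q x)"
proof -
  have "ptime (\<lambda>x. if P x then of_bool_tree (Q x) else Leaf)"
    using assms by (intro ptime_if ptime_Leaf) (simp_all add: pdec_def)
  then show ?thesis
    unfolding pdec_def of_bool_tree_def by (rule back_subst[of ptime]) auto
qed

lemma pdec_not:
  assumes "pdec P"
  shows "pdec (\<lambda>x. \<not> P x)"
proof -
  have "ptime (\<lambda>x. if P x then Leaf else Node Leaf Leaf)"
    using assms by (intro ptime_if ptime_Leaf ptime_Node)
  then show ?thesis
    unfolding pdec_def of_bool_tree_def by (rule back_subst[of ptime]) auto
qed

lemma pdec_disj: "pdec P \<Longrightarrow> pdec Q \<Longrightarrow> pdec (\<lambda>x. P x \<or> Q x)"
  using pdec_not[OF pdec_conj[OF pdec_not pdec_not], of P Q] by simp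

text \<open>The predicate takes a pair of outer input and list element, so nested searches can refer
  to everything bound outside.\<close>

lemma pdec_bex:
  assumes P: "pdec (\<lambda>z. P (left z) (right z))" and l: "ptime l"
  shows "pdec (\<lambda>x. \<exists>a\<in>set (items (l x)). P x a)"
proof -
  let ?h = "\<lambda>x a acc. if P x a then Node Leaf Leaf else acc"
  have "pdec (\<lambda>z. P (left z) (left (right z)))"
    using ptime_comp[OF P[unfolded pdec_def], of "\<lambda>z. Node (left z) (left (right z))"]
    by (simp add: pdec_def ptime_Node ptime_left ptime_right ptime_id)
  then have "ptime (\<lambda>x. fold (?h x) (items (l x)) Leaf)"
    by (intro ptime_fold[where q = "[:3:]"] l ptime_if ptime_Leaf ptime_Node ptime_right ptime_id)
      auto
  moreover have "fold (?h x) ys acc = (if \<exists>a\<in>set ys. P x a then Node Leaf Leaf else acc)" for x ys acc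
    by (induction ys arbitrary: acc) auto
  ultimately show ?thesis
    by (simp add: pdec_def of_bool_tree_def)
qed

text \<open>Serves to undo the reversal caused by loops that push their results onto an
  accumulator.\<close>

lemma ptime_rev:
  assumes "ptime l"
  shows "ptime (\<lambda>x. enc_list (\<lambda>x. x) (rev (items (l x))))"
proof -
  have "ptime (\<lambda>x. fold Node (items (l x)) Leaf)"
    by (intro ptime_fold[where h = "\<lambda>x. Node" and q = "[:1, 1:]"] assms ptime_Leaf ptime_Node
        ptime_left ptime_right ptime_id) auto
  moreover have "fold Node ys acc = enc_list (\<lambda>x. x) (rev ys @ items acc)" for ys acc
    by (induction ys arbitrary: acc) auto
  ultimately show ?thesis by simp
qed

definition filter_tree :: "(tree \<Rightarrow> bool) \<Rightarrow> tree \<Rightarrow> tree" where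
  "filter_tree P l = enc_list (\<lambda>x. x) (filter P (items l))"

lemma filter_tree_enc_list: "filter_tree P (enc_list f xs) = enc_list f (filter (\<lambda>x. P (f x)) xs)"
  by (simp add: filter_tree_def filter_map o_def enc_list_map)

lemma nodes_filter_tree_le: "nodes (filter_tree P l) \<le> nodes l"
  by (induction l) (auto simp: filter_tree_def)

lemma ptime_filter:
  assumes P: "pdec (\<lambda>z. P (left z) (right z))" and l: "ptime l"
  shows "ptime (\<lambda>x. filter_tree (P x) (l x))"
proof -
  let ?h = "\<lambda>x a acc. if P x a then Node a acc else acc"
  have "pdec (\<lambda>z. P (left z) (left (right z)))"
    using ptime_comp[OF P[unfolded pdec_def], of "\<lambda>z. Node (left z) (left (right z))"]
    by (simp add: pdec_def ptime_Node ptime_left ptime_right ptime_id)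
  then have "ptime (\<lambda>x. fold (?h x) (items (l x)) Leaf)"
    by (intro ptime_fold[where q = "[:1, 1:]"] l ptime_if ptime_Leaf ptime_Node ptime_left ptime_right
        ptime_id) auto
  moreover have "fold (?h x) ys acc = enc_list (\<lambda>x. x) (rev (filter (P x) ys) @ items acc)" for x ys acc
    by (induction ys arbitrary: acc) auto
  ultimately have "ptime (\<lambda>x. enc_list (\<lambda>x. x) (rev (filter (P x) (items (l x)))))"
    by simp
  from ptime_rev[OF this] show ?thesis
    by (simp add: filter_tree_def)
qed

lemmas ptime_intros = ptime_id ptime_Leaf ptime_left ptime_right ptime_Node ptime_if ptime_filter
  pdec_eq pdec_conj pdec_disj pdec_not pdec_bex

section \<open>Polynomial-time implementation\<close>

lemma ptime_nodes_bound:
  assumes "ptime f"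
  obtains p where "\<And>x. nodes (f x) \<le> poly p (nodes x)"
  using assms implements_nodes unfolding ptime_def by blast

text \<open>One list is cut down by one cell per entry of the other. The extra cell put in front
  makes the test come out as non-strict: \<open>Leaf\<close> remains iff the first list is strictly
  longer.\<close>

lemma pdec_length_le:
  assumes "ptime f" "ptime g"
  shows "pdec (\<lambda>x. length (items (f x)) \<le> length (items (g x)))"
proof -
  have fold_right: "items (fold (\<lambda>_. right) ys acc) = drop (length ys) (items acc)" for ys :: "tree list" and acc
  proof (induction ys arbitrary: acc)
    case (Cons y ys)
    then show ?case by (cases acc) simp_all
  qed simp
  have "ptime (\<lambda>x. fold (\<lambda>_. right) (items (f x)) (Node Leaf (g x)))"
    by (rule ptime_fold[where h = "\<lambda>_ _. right" and q = 0])
      (simp_all add: assms ptime_intros nodes_right_le)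
  then have "pdec (\<lambda>x. \<not> fold (\<lambda>_. right) (items (f x)) (Node Leaf (g x)) = Leaf)"
    by (intro pdec_not pdec_eq ptime_Leaf)
  moreover have "fold (\<lambda>_. right) ys (Node Leaf y) = Leaf \<longleftrightarrow> \<not> length ys \<le> length (items y)" for ys :: "tree list" and y
  proof -
    have "fold (\<lambda>_. right) ys (Node Leaf y) = Leaf \<longleftrightarrow> items (fold (\<lambda>_. right) ys (Node Leaf y)) = []"
      by (cases "fold (\<lambda>_. right) ys (Node Leaf y)") simp_all
    then show ?thesis unfolding fold_right by auto
  qed
  ultimately show ?thesis by simp
qed

primrec succ_tree :: "tree \<Rightarrow> tree" where
  "succ_tree Leaf = Node (Node Leaf Leaf) Leaf"
| "succ_tree (Node b r) = (if b = Leaf then Node (Node Leaf Leaf) r else Node Leaf (succ_tree r))"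

lemma succ_tree_enc_nat: "succ_tree (enc_nat n) = enc_nat (Suc n)"
proof (induction n rule: less_induct)
  case (less n)
  consider "n = 0" | "n \<noteq> 0" "even n" | "n \<noteq> 0" "odd n" by blast
  then show ?case
  proof cases
    case 1
    then show ?thesis using enc_nat_pos[of 1] by (simp add: enc_nat_0)
  next
    case 2
    then show ?thesis using enc_nat_pos[of n] enc_nat_pos[of "Suc n"] by simp
  next
    case 3
    then have "succ_tree (enc_nat (n div 2)) = enc_nat (Suc (n div 2))" by (intro less.IH) simp
    moreover have "Suc n div 2 = Suc (n div 2)" using 3 by presburger
    ultimately show ?thesis using 3 enc_nat_pos[of n] enc_nat_pos[of "Suc n"] by simp
  qed
qed

lemma nodes_succ_tree_le: "nodes (succ_tree x) \<le> nodes x + 4"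
proof (induction x)
  case (Node a b)
  then show ?case using nodes_pos[of a] by auto
qed simp

lemma ptime_succ_tree:
  assumes "ptime f"
  shows "ptime (\<lambda>x. succ_tree (f x))"
proof -
  define one where "one = Node Leaf Leaf"
  \<comment> \<open>The recursion of \<open>succ_tree\<close> becomes a loop from the least
    significant bit: the left part of the accumulator is the carry, initially \<open>one\<close>,
    and the right part lists the digits written so far in reverse. A carry left at the end is added
    as a top digit by \<open>out\<close>.\<close>
  define h where "h a acc = (if left acc = Leaf then Node Leaf (Node a (right acc))
    else if a = Leaf then Node Leaf (Node one (right acc)) else Node one (Node Leaf (right acc)))" for a acc
  define out where "out r = (if left r = Leaf then right r else Node one (right r))" for r
  have one: "ptime (\<lambda>x. one)" unfolding one_def by (intro ptime_intros)
  have no_carry: "fold h ys (Node Leaf acc) = Node Leaf (enc_list (\<lambda>x. x) (rev ys @ items acc))" for ys acc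
    by (induction ys arbitrary: acc) (simp_all add: h_def)
  have h_one: "h a (Node one acc) =
      (if a = Leaf then Node Leaf (Node one acc) else Node one (Node Leaf acc))" for a acc
    by (simp add: h_def one_def)
  have out: "out (Node Leaf acc) = acc" "out (Node one acc) = Node one acc" for acc
    by (simp_all add: out_def one_def)
  have carry: "rev (items (out (fold h (items x) (Node one acc)))) = rev (items acc) @ items (succ_tree x)" for x acc
    by (induction x arbitrary: acc) (simp_all add: h_one out one_def[symmetric] no_carry)
  have "ptime (\<lambda>x. fold h (items (f x)) (Node one Leaf))"
  proof (rule ptime_fold[where h = "\<lambda>_. h" and q = "[:10, 1:]"])
    show "ptime (\<lambda>z. h (left (right z)) (right (right z)))"
      unfolding h_def by (intro ptime_intros one)
    show "nodes (h a acc) \<le> nodes acc + poly [:10, 1:] (nodes x + nodes a)" for x a acc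
      by (cases acc) (auto simp: h_def one_def)
  qed (intro assms ptime_intros one)+
  then have "ptime (\<lambda>x. enc_list (\<lambda>x. x) (rev (items (out (fold h (items (f x)) (Node one Leaf))))))"
    unfolding out_def by (intro ptime_rev ptime_intros one)
  then show ?thesis by (simp add: carry)
qed

text \<open>From here on the list algorithm is restated on raw trees, built only from operations
  with closure lemmas for polynomial time.\<close>

definition has_color_tree :: "tree \<Rightarrow> tree \<Rightarrow> tree \<Rightarrow> bool" where
  "has_color_tree cs A v \<longleftrightarrow> (\<exists>p\<in>set (items cs). left p = v \<and> (\<exists>j\<in>set (items A). j = right p))"

definition arcs_within_tree :: "tree \<Rightarrow> tree \<Rightarrow> tree \<Rightarrow> tree" where
  "arcs_within_tree cs fs A =
     filter_tree (\<lambda>e. has_color_tree cs A (left e) \<and> has_color_tree cs A (right e)) fs"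

definition high_tree :: "tree \<Rightarrow> tree \<Rightarrow> tree \<Rightarrow> tree \<Rightarrow> bool" where
  "high_tree cs fs A v \<longleftrightarrow> length (items A) \<le>
     length (items (filter_tree (\<lambda>e. left e = v \<or> right e = v) (arcs_within_tree cs fs A)))"

definition crowded_tree :: "tree \<Rightarrow> tree \<Rightarrow> tree \<Rightarrow> tree \<Rightarrow> bool" where
  "crowded_tree cs fs A i \<longleftrightarrow> (\<exists>p\<in>set (items cs). \<exists>q\<in>set (items cs). right p = i \<and> right q = i \<and>
     \<not> left p = left q \<and> high_tree cs fs A (left p) \<and> high_tree cs fs A (left q))"

definition shrink_tree :: "tree \<Rightarrow> tree \<Rightarrow> tree \<Rightarrow> tree" where
  "shrink_tree cs fs A = (if filter_tree (crowded_tree cs fs A) A = Leaf then A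
     else filter_tree (\<lambda>j. \<not> j = left (filter_tree (crowded_tree cs fs A) A)) A)"

definition free_colors_tree :: "tree \<Rightarrow> tree \<Rightarrow> tree \<Rightarrow> tree" where
  "free_colors_tree cs fs K = fold (\<lambda>_. shrink_tree cs fs) (items K) K"

definition palette_tree :: "tree \<Rightarrow> tree \<Rightarrow> tree" where
  "palette_tree k fs = fold (\<lambda>_ K. if succ_tree (left K) = k then K else Node (succ_tree (left K)) K)
     (items fs) (Node Leaf Leaf)"

definition blocked_tree :: "tree \<Rightarrow> tree \<Rightarrow> tree \<Rightarrow> tree \<Rightarrow> bool" where
  "blocked_tree es R v i \<longleftrightarrow> (\<exists>e\<in>set (items es). \<exists>p\<in>set (items R). right p = i \<and>
     (left e = v \<and> right e = left p \<or> right e = v \<and> left e = left p))"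

definition greedy_step_tree :: "tree \<Rightarrow> tree \<Rightarrow> tree \<Rightarrow> tree \<Rightarrow> tree" where
  "greedy_step_tree es A v R = (if \<exists>p\<in>set (items R). left p = v then R
     else Node (Node v (left (filter_tree (\<lambda>i. \<not> blocked_tree es R v i) A))) R)"

definition greedy_tree :: "tree \<Rightarrow> tree \<Rightarrow> tree \<Rightarrow> tree \<Rightarrow> tree" where
  "greedy_tree vs fs cs A = fold (greedy_step_tree (arcs_within_tree cs fs A) A) (items vs)
     (filter_tree (\<lambda>p. \<not> (\<exists>j\<in>set (items A). j = right p) \<or> high_tree cs fs A (left p)) cs)"

definition recolor_tree :: "tree \<Rightarrow> tree \<Rightarrow> tree \<Rightarrow> tree \<Rightarrow> tree" where
  "recolor_tree k vs fs cs = greedy_tree vs fs cs (free_colors_tree cs fs (palette_tree k fs))"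

section \<open>Agreement of the tree algorithm with the list algorithm on encodings\<close>

lemma left_right_enc_pair [simp]:
  "left (enc_pair p) = enc_nat (fst p)" "right (enc_pair p) = enc_nat (snd p)"
  by (simp_all add: enc_pair_def)

lemma left_enc_list: "left (enc_list enc_nat xs) = enc_nat (first xs)"
  by (cases xs) (simp_all add: enc_nat_0)

lemma enc_list_eq_Leaf [simp]: "enc_list f xs = Leaf \<longleftrightarrow> xs = []"
  by (cases xs) simp_all

lemma has_color_tree_enc:
  "has_color_tree (enc_list enc_pair cs) (enc_list enc_nat A) (enc_nat v) \<longleftrightarrow> has_color cs A v"
  by (simp add: has_color_tree_def has_color_def image_iff enc_nat_inject)

lemma arcs_within_tree_enc:
  "arcs_within_tree (enc_list enc_pair cs) (enc_list enc_pair fs) (enc_list enc_nat A) = enc_list enc_pair (arcs_within cs fs A)"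
  by (simp add: arcs_within_tree_def arcs_within_def filter_tree_enc_list has_color_tree_enc)

lemma high_tree_enc:
  "high_tree (enc_list enc_pair cs) (enc_list enc_pair fs) (enc_list enc_nat A) (enc_nat v) \<longleftrightarrow> high cs fs A v"
  by (simp add: high_tree_def high_def filter_tree_enc_list arcs_within_tree_enc enc_nat_inject)

lemma crowded_tree_enc:
  "crowded_tree (enc_list enc_pair cs) (enc_list enc_pair fs) (enc_list enc_nat A) (enc_nat i) \<longleftrightarrow> crowded cs fs A i"
  by (simp add: crowded_tree_def crowded_def high_tree_enc enc_nat_inject)

lemma shrink_tree_enc:
  "shrink_tree (enc_list enc_pair cs) (enc_list enc_pair fs) (enc_list enc_nat A) = enc_list enc_nat (shrink cs fs A)"
  by (simp add: shrink_tree_def shrink_def filter_tree_enc_list crowded_tree_enc left_enc_list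
      enc_nat_inject)

text \<open>Lifts the encoding lemma of a single step to the whole loop.\<close>

lemma fold_map_commute:
  assumes "\<And>a s. h' (f a) (g s) = g (h a s)"
  shows "fold h' (map f xs) (g s) = g (fold h xs s)"
  by (induction xs arbitrary: s) (simp_all add: assms)

lemma free_colors_tree_enc:
  "free_colors_tree (enc_list enc_pair cs) (enc_list enc_pair fs) (enc_list enc_nat K) = enc_list enc_nat (free_colors cs fs K)"
  unfolding free_colors_tree_def free_colors_def items_enc_list
  by (rule fold_map_commute) (rule shrink_tree_enc)

lemma palette_tree_enc: "palette_tree (enc_nat k) (enc_list enc_pair fs) = enc_list enc_nat (palette k fs)"
proof -
  have "Node Leaf Leaf = enc_list enc_nat [0]" by (simp add: enc_nat_0)
  then show ?thesis
    unfolding palette_tree_def palette_def items_enc_list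
    by (simp only:, intro fold_map_commute) (simp add: left_enc_list succ_tree_enc_nat enc_nat_inject)
qed

lemma blocked_tree_enc:
  "blocked_tree (enc_list enc_pair fs) (enc_list enc_pair R) (enc_nat v) (enc_nat i) \<longleftrightarrow> blocked fs R v i"
  by (simp add: blocked_tree_def blocked_def enc_nat_inject)

lemma greedy_step_tree_enc:
  "greedy_step_tree (enc_list enc_pair es) (enc_list enc_nat A) (enc_nat v) (enc_list enc_pair R) =
    enc_list enc_pair (greedy_step es A v R)"
  by (simp add: greedy_step_tree_def greedy_step_def filter_tree_enc_list blocked_tree_enc left_enc_list
      enc_nat_inject) (simp add: enc_pair_def)

lemma recolor_tree_enc:
  "recolor_tree (enc_nat k) (enc_list enc_nat vs) (enc_list enc_pair fs) (enc_list enc_pair cs) =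
    enc_list enc_pair (recolor k vs fs cs)"
proof -
  define A where "A = free_colors cs fs (palette k fs)"
  have "filter_tree (\<lambda>p. \<not> (\<exists>j\<in>set (items (enc_list enc_nat A)). j = right p) \<or>
      high_tree (enc_list enc_pair cs) (enc_list enc_pair fs) (enc_list enc_nat A) (left p)) (enc_list enc_pair cs) =
    enc_list enc_pair (filter (\<lambda>p. \<not> (\<exists>j\<in>set A. j = snd p) \<or> high cs fs A (fst p)) cs)"
    unfolding filter_tree_enc_list
    by (intro arg_cong[where f = "enc_list enc_pair"] filter_cong) (auto simp: high_tree_enc enc_nat_inject)
  then show ?thesis
    unfolding recolor_tree_def recolor_def greedy_tree_def greedy_def palette_tree_enc free_colors_tree_enc
      A_def[symmetric] arcs_within_tree_enc items_enc_list[of enc_nat vs]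
    by (simp only: fold_map_commute[where g = "enc_list enc_pair" and f = enc_nat and
        h' = "greedy_step_tree (enc_list enc_pair (arcs_within cs fs A)) (enc_list enc_nat A)" and
        h = "greedy_step (arcs_within cs fs A) A", OF greedy_step_tree_enc])
qed

section \<open>Polynomial time bounds for the tree algorithm\<close>

lemma pdec_has_color_tree:
  assumes "ptime cs" "ptime A" "ptime v"
  shows "pdec (\<lambda>x. has_color_tree (cs x) (A x) (v x))"
  \<comment> \<open>Under a search the input becomes a pair; \<open>ptime_comp\<close> lets the
    arguments read their own input off it by projections. The same device recurs below.\<close>
  unfolding has_color_tree_def by (intro ptime_intros assms[THEN ptime_comp])

lemma ptime_arcs_within_tree:
  assumes "ptime cs" "ptime fs" "ptime A"
  shows "ptime (\<lambda>x. arcs_within_tree (cs x) (fs x) (A x))"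
  unfolding arcs_within_tree_def by (intro ptime_intros pdec_has_color_tree assms[THEN ptime_comp])

lemma pdec_high_tree:
  assumes "ptime cs" "ptime fs" "ptime A" "ptime v"
  shows "pdec (\<lambda>x. high_tree (cs x) (fs x) (A x) (v x))"
  unfolding high_tree_def
  by (intro ptime_intros pdec_length_le ptime_arcs_within_tree assms[THEN ptime_comp])

lemma pdec_crowded_tree:
  assumes "ptime cs" "ptime fs" "ptime A" "ptime i"
  shows "pdec (\<lambda>x. crowded_tree (cs x) (fs x) (A x) (i x))"
  unfolding crowded_tree_def by (intro ptime_intros pdec_high_tree assms[THEN ptime_comp])

lemma ptime_shrink_tree:
  assumes "ptime cs" "ptime fs" "ptime A"
  shows "ptime (\<lambda>x. shrink_tree (cs x) (fs x) (A x))"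
  unfolding shrink_tree_def by (intro ptime_intros pdec_crowded_tree assms[THEN ptime_comp])

lemma ptime_free_colors_tree:
  assumes "ptime cs" "ptime fs" "ptime K"
  shows "ptime (\<lambda>x. free_colors_tree (cs x) (fs x) (K x))"
  unfolding free_colors_tree_def
\<comment> \<open>The growth bound is 0 since filtering never enlarges a list.\<close>
proof (rule ptime_fold[where h = "\<lambda>x _. shrink_tree (cs x) (fs x)" and q = 0])
  show "nodes (shrink_tree (cs x) (fs x) acc) \<le> nodes acc + poly 0 (nodes x + nodes a)" for x a acc
    by (simp add: shrink_tree_def nodes_filter_tree_le)
qed (intro ptime_intros ptime_shrink_tree assms[THEN ptime_comp])+

text \<open>Each round adds a color whose size depends on the head of the accumulator, so
  \<open>ptime_fold\<close> does not fit directly. The head gains at most 4 nodes per round, which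
  bounds the list quadratically in the number of rounds.\<close>

lemma ptime_palette_tree:
  assumes "ptime k" "ptime fs"
  shows "ptime (\<lambda>x. palette_tree (k x) (fs x))"
proof -
  obtain p where p: "\<And>x. nodes (fs x) \<le> poly p (nodes x)"
    using ptime_nodes_bound[OF assms(2)] by blast
  let ?h = "\<lambda>x (_ :: tree) K. if succ_tree (left K) = k x then K else Node (succ_tree (left K)) K"
  have size: "nodes (left (fold (?h x) ys (Node Leaf Leaf))) \<le> 1 + 4 * length ys \<and>
    nodes (fold (?h x) ys (Node Leaf Leaf)) \<le> 3 + length ys * (4 * length ys + 6)" for x ys
  proof (induction ys rule: rev_induct)
    case (snoc y ys)
    define K where "K = fold (?h x) ys (Node Leaf Leaf)"
    have "nodes (succ_tree (left K)) \<le> 5 + 4 * length ys"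
      using nodes_succ_tree_le[of "left K"] snoc by (simp add: K_def)
    with snoc show ?case by (auto simp: K_def[symmetric] algebra_simps)
  qed simp
  show ?thesis
    unfolding palette_tree_def
  proof (rule ptime_fold_bounded[where h = ?h and q = "of_nat 3 + p * (of_nat 4 * p + of_nat 6)"])
    show "ptime (\<lambda>z. ?h (left z) (left (right z)) (right (right z)))"
      by (intro ptime_intros ptime_succ_tree assms[THEN ptime_comp])
    show "nodes (fold (?h x) ys (Node Leaf Leaf)) \<le> poly (of_nat 3 + p * (of_nat 4 * p + of_nat 6)) (nodes x)"
      if "items (fs x) = ys @ zs" for x ys zs
    proof -
      have "length ys \<le> poly p (nodes x)"
        using length_items_less[of "fs x"] that p[of x] by simp
      then have "length ys * (4 * length ys + 6) \<le> poly p (nodes x) * (4 * poly p (nodes x) + 6)"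
        by (intro mult_mono) auto
      with size[of x ys] show ?thesis by simp
    qed
  qed (intro ptime_intros assms)+
qed

lemma pdec_blocked_tree:
  assumes "ptime es" "ptime R" "ptime v" "ptime i"
  shows "pdec (\<lambda>x. blocked_tree (es x) (R x) (v x) (i x))"
  unfolding blocked_tree_def by (intro ptime_intros assms[THEN ptime_comp])

lemma ptime_greedy_step_tree:
  assumes "ptime es" "ptime A" "ptime v" "ptime R"
  shows "ptime (\<lambda>x. greedy_step_tree (es x) (A x) (v x) (R x))"
  unfolding greedy_step_tree_def by (intro ptime_intros pdec_blocked_tree assms[THEN ptime_comp])

lemma ptime_greedy_tree:
  assumes "ptime vs" "ptime fs" "ptime cs" "ptime A"
  shows "ptime (\<lambda>x. greedy_tree (vs x) (fs x) (cs x) (A x))"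
proof -
  obtain p where p: "\<And>x. nodes (A x) \<le> poly p (nodes x)"
    using ptime_nodes_bound[OF assms(4)] by blast
  show ?thesis
    unfolding greedy_tree_def
  \<comment> \<open>A round adds at most one pair, made of the vertex and a tree no larger than the
    color list, independently of the accumulator.\<close>
  proof (rule ptime_fold[where q = "[:2, 1:] + p" and
        h = "\<lambda>x. greedy_step_tree (arcs_within_tree (cs x) (fs x) (A x)) (A x)"])
    show "nodes (greedy_step_tree (arcs_within_tree (cs x) (fs x) (A x)) (A x) v R)
      \<le> nodes R + poly ([:2, 1:] + p) (nodes x + nodes v)" for x v R
    proof -
      let ?P = "\<lambda>i. \<not> blocked_tree (arcs_within_tree (cs x) (fs x) (A x)) R v i"
      have "nodes (left (filter_tree ?P (A x))) \<le> nodes (A x)"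
        using nodes_left_le nodes_filter_tree_le le_trans by blast
      also have "\<dots> \<le> poly p (nodes x)" by (rule p)
      also have "\<dots> \<le> poly p (nodes x + nodes v)" by (rule poly_nat_mono) simp
      finally show ?thesis by (simp add: greedy_step_tree_def)
    qed
  qed (intro ptime_intros ptime_greedy_step_tree ptime_arcs_within_tree pdec_high_tree
      assms[THEN ptime_comp])+
qed

lemma ptime_recolor_tree:
  assumes "ptime k" "ptime vs" "ptime fs" "ptime cs"
  shows "ptime (\<lambda>x. recolor_tree (k x) (vs x) (fs x) (cs x))"
  unfolding recolor_tree_def
  by (intro ptime_greedy_tree ptime_free_colors_tree ptime_palette_tree assms)

lemma ptime_computes:
  assumes "ptime f"
  shows "\<exists>prog p. \<forall>x. \<exists>t. computes prog x t (f x) \<and> t \<le> poly p (nodes x)"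
proof -
  from assms obtain c N p where c: "implements c N p f" unfolding ptime_def by blast
  have "\<exists>t. computes c x t (f x) \<and> t \<le> poly p (nodes x)" for x
  proof -
    obtain s' where "runs c ((\<lambda>_. Leaf)(0 := x)) (poly p (nodes x)) s'" "s' 0 = f x"
      using implements_runs[OF c, of "(\<lambda>_. Leaf)(0 := x)"] by auto
    then show ?thesis unfolding computes_def runs_def by blast
  qed
  then show ?thesis by blast
qed

section \<open>Acyclic color classes\<close>

lemma cas_cong:
  assumes "tail H = tail G" "head H = head G"
  shows "pre_digraph.cas H u p v = pre_digraph.cas G u p v"
  by (induction p arbitrary: u) (simp_all add: pre_digraph.cas.simps assms)

lemma awalk_verts_cong:
  assumes "tail H = tail G" "head H = head G"
  shows "pre_digraph.awalk_verts H u p = pre_digraph.awalk_verts G u p"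
  by (induction p arbitrary: u) (simp_all add: pre_digraph.awalk_verts.simps assms)

text \<open>Beyond membership of its vertices and arcs, being a cycle depends on \<open>tail\<close>
  and \<open>head\<close> alone, and neither deleting arcs nor inducing a subdigraph changes
  these.\<close>

lemma cycle_cong:
  assumes "pre_digraph.cycle G p" "tail H = tail G" "head H = head G"
    and "verts G \<subseteq> verts H" "arcs G \<inter> set p \<subseteq> arcs H"
  shows "pre_digraph.cycle H p"
  using assms unfolding pre_digraph.cycle_def pre_digraph.awalk_def
  by (fastforce simp: cas_cong[OF assms(2,3)] awalk_verts_cong[OF assms(2,3)])

lemma acyclic_digraph_subset:
  assumes "acyclic_digraph H" "tail H = tail G" "head H = head G" "verts G \<subseteq> verts H" "arcs G \<subseteq> arcs H"
  shows "acyclic_digraph G"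
  using assms cycle_cong[of G _ H] unfolding acyclic_digraph_def by blast

lemma is_coloring_induced:
  assumes "is_coloring k D c" "S \<subseteq> verts D"
  shows "is_coloring k (D \<restriction> S) c"
proof -
  have "acyclic_digraph ((D \<restriction> S) \<restriction> {v \<in> S. c v = i})" if "i < k" for i
    by (rule acyclic_digraph_subset[of "D \<restriction> {v \<in> verts D. c v = i}"])
      (use assms that in \<open>auto simp: is_coloring_def\<close>)
  with assms show ?thesis by (auto simp: is_coloring_def)
qed

text \<open>A class with color in \<open>A\<close> contains no arc of F and so induces a subdigraph
  of D - F; any other class is contained in the class of \<open>c\<close> with the same
  color.\<close>

lemma is_coloring_of_free_classes:
  assumes F: "feedback_arc_set D F"
    and c: "is_coloring k (D \<restriction> endpoints D F) c"
    and A: "A \<subseteq> {..<k}"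
    and c': "\<And>v. v \<in> verts D \<Longrightarrow> c' v \<in> A \<or> v \<in> endpoints D F \<and> c' v = c v"
    and free: "\<And>e. e \<in> F \<Longrightarrow> tail D e \<in> verts D \<Longrightarrow> head D e \<in> verts D \<Longrightarrow>
      c' (tail D e) = c' (head D e) \<Longrightarrow> c' (tail D e) \<notin> A"
  shows "is_coloring k D c'"
proof -
  have "acyclic_digraph (D \<restriction> {v \<in> verts D. c' v = i})" if i: "i < k" for i
  proof (cases "i \<in> A")
    case True
    have "e \<notin> F" if "tail D e \<in> verts D" "head D e \<in> verts D"
      "c' (tail D e) = i" "c' (head D e) = i" for e
      using free[of e] that True by auto
    moreover have "acyclic_digraph (del_arcs D F)" using F by (simp add: feedback_arc_set_def)
    ultimately show ?thesis
      by (elim acyclic_digraph_subset) (auto simp: del_arcs_def)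
  next
    case False
    then have "v \<in> endpoints D F \<and> c v = i" if "v \<in> verts D" "c' v = i" for v
      using c'[OF that(1)] that(2) by auto
    moreover have "acyclic_digraph ((D \<restriction> endpoints D F) \<restriction> {v \<in> endpoints D F. c v = i})"
      using c i by (simp add: is_coloring_def)
    ultimately show ?thesis
      by (elim acyclic_digraph_subset) auto
  qed
  moreover have "c' v < k" if "v \<in> verts D" for v
    using c'[OF that] c A by (auto simp: is_coloring_def)
  ultimately show ?thesis by (simp add: is_coloring_def)
qed

text \<open>The two opposite arcs would form a cycle of length two inside one class.\<close>

lemma coloring_no_mono_digon:
  assumes c: "is_coloring k (D \<restriction> S) c"
    and e: "e \<in> arcs D" "e' \<in> arcs D" "tail D e = u" "head D e = v" "tail D e' = v" "head D e' = u"
    and S: "u \<in> S" "v \<in> S" "u \<noteq> v"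
  shows "c u \<noteq> c v"
proof
  assume eq: "c u = c v"
  let ?H = "(D \<restriction> S) \<restriction> {w \<in> S. c w = c u}"
  have "pre_digraph.cycle ?H [e, e']"
    unfolding pre_digraph.cycle_def pre_digraph.awalk_def
    by (rule exI[of _ u]) (use e S eq in \<open>simp add: pre_digraph.cas.simps pre_digraph.awalk_verts.simps\<close>)
  moreover have "acyclic_digraph ?H" using c S by (simp add: is_coloring_def)
  ultimately show False by (auto simp: acyclic_digraph_def)
qed

text \<open>Serves both halves of the theorem. Arcs of an arbitrary type are replaced by their pairs
  of ends, the form that the algorithm works on.\<close>

lemma recolor_is_coloring:
  assumes "digraph D" "feedback_arc_set D F" "1 \<le> k" "card F \<le> k\<^sup>2 - 1"
    and c: "is_coloring k (D \<restriction> endpoints D F) c"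
    and vs: "set vs = verts D"
    and fs: "lists_set fs (arc_to_ends D ` F)"
    and cs: "lists_set cs ((\<lambda>v. (v, c v)) ` endpoints D F)"
  shows "\<exists>c'. is_coloring k D c' \<and> lists_set (recolor k vs fs cs) ((\<lambda>v. (v, c' v)) ` verts D)"
proof -
  interpret digraph D by fact
  have F: "F \<subseteq> arcs D" using assms(2) by (simp add: feedback_arc_set_def)
  interpret feedback_coloring c "endpoints D F" cs fs
  proof
    show "distinct fs" "distinct cs" "set cs = (\<lambda>v. (v, c v)) ` endpoints D F"
      using fs cs by (simp_all add: lists_set_def)
    have E: "\<exists>e\<in>F. tail D e = u \<and> head D e = v" if "(u, v) \<in> set fs" for u v
      using that fs by (auto simp: lists_set_def arc_to_ends_def)
    show ends: "u \<in> endpoints D F \<and> v \<in> endpoints D F" if "(u, v) \<in> set fs" for u v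
      using E[OF that] by (auto simp: endpoints_def)
    show loop: "u \<noteq> v" if "(u, v) \<in> set fs" for u v
      using E[OF that] F no_loops by auto
    show "c u \<noteq> c v" if uv: "(u, v) \<in> set fs" "(v, u) \<in> set fs" for u v
    proof -
      obtain e e' where "e \<in> F" "e' \<in> F" "tail D e = u" "head D e = v" "tail D e' = v" "head D e' = u"
        using E[OF uv(1)] E[OF uv(2)] by blast
      with F ends[OF uv(1)] loop[OF uv(1)] show ?thesis
        by (intro coloring_no_mono_digon[OF c, of e e']) auto
    qed
  qed
  have "length fs = card (arc_to_ends D ` F)"
    using fs distinct_card[of fs] by (simp add: lists_set_def)
  also have "\<dots> \<le> card F" using F by (intro card_image_le) (auto intro: finite_subset)
  finally have len: "length fs \<le> k\<^sup>2 - 1" using assms(4) by simp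
  have sub: "endpoints D F \<subseteq> set vs" using F vs by (auto simp: endpoints_def)
  obtain A where A: "A \<subseteq> {..<k}"
    and R: "distinct (map fst (recolor k vs fs cs))" "fst ` set (recolor k vs fs cs) = set vs"
      "\<And>v i. (v, i) \<in> set (recolor k vs fs cs) \<Longrightarrow> i \<in> A \<or> v \<in> endpoints D F \<and> i = c v"
      "\<And>u v i. (u, v) \<in> set fs \<Longrightarrow> (u, i) \<in> set (recolor k vs fs cs) \<Longrightarrow>
        (v, i) \<in> set (recolor k vs fs cs) \<Longrightarrow> i \<notin> A"
    using recolor_free_classes[OF assms(3) len sub] by blast
  \<comment> \<open>The output list has distinct keys, exactly the vertices of \<open>D\<close>, so
    it is the graph of this function on them.\<close>
  define c' where "c' v = the (map_of (recolor k vs fs cs) v)" for v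
  have c'_iff: "(v, i) \<in> set (recolor k vs fs cs) \<longleftrightarrow> v \<in> verts D \<and> i = c' v" for v i
  proof -
    have "map_of (recolor k vs fs cs) v = Some i \<longleftrightarrow> v \<in> verts D \<and> i = c' v"
    proof (cases "map_of (recolor k vs fs cs) v")
      case None
      then have "v \<notin> verts D" using R(2) vs by (simp add: map_of_eq_None_iff)
      with None show ?thesis by simp
    next
      case (Some j)
      then have "v \<in> verts D" using R(2) vs map_of_SomeD[OF Some] by force
      with Some show ?thesis by (auto simp: c'_def)
    qed
    with R(1) show ?thesis by simp
  qed
  have "is_coloring k D c'"
  proof (rule is_coloring_of_free_classes[OF assms(2) c A])
    show "c' v \<in> A \<or> v \<in> endpoints D F \<and> c' v = c v" if "v \<in> verts D" for v
      using R(3)[of v "c' v"] that by (simp add: c'_iff)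
    show "c' (tail D e) \<notin> A" if "e \<in> F" "tail D e \<in> verts D" "head D e \<in> verts D"
      "c' (tail D e) = c' (head D e)" for e
    proof -
      have "(tail D e, head D e) \<in> set fs" using fs that(1) by (auto simp: lists_set_def arc_to_ends_def)
      then show ?thesis by (rule R(4)) (use that in \<open>auto simp: c'_iff\<close>)
    qed
  qed
  moreover have "lists_set (recolor k vs fs cs) ((\<lambda>v. (v, c' v)) ` verts D)"
    using R(1) by (auto simp: lists_set_def distinct_map c'_iff)
  ultimately show ?thesis by blast
qed

theorem theorem7:
  shows
    "(\<forall>(k::nat) (D :: ('a,'b) pre_digraph) F.
        1 \<le> k \<and> digraph D \<and> feedback_arc_set D F \<and> card F \<le> k^2 - 1 \<longrightarrow>
        (colorable k D \<longleftrightarrow> colorable k (D \<restriction> endpoints D F)))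
     \<and>
     (\<exists>(prog :: com) (p :: nat poly).
        \<forall>(k::nat) (D :: nat pair_pre_digraph) F c x.
          1 \<le> k \<and> pair_digraph D \<and> feedback_arc_set (with_proj D) F \<and> card F \<le> k^2 - 1 \<and>
          is_coloring k (with_proj D \<restriction> endpoints (with_proj D) F) c \<and>
          encodes_instance k D F c x \<longrightarrow>
          (\<exists>t y c'. computes prog x t y \<and> t \<le> poly p (nodes x) \<and>
                    is_coloring k (with_proj D) c' \<and> encodes_coloring (pverts D) c' y))"
proof (intro conjI allI impI)
  fix k and D :: "('a, 'b) pre_digraph" and F
  assume *: "1 \<le> k \<and> digraph D \<and> feedback_arc_set D F \<and> card F \<le> k^2 - 1"
  then interpret digraph D by blast
  have F: "F \<subseteq> arcs D" using * by (simp add: feedback_arc_set_def)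
  then have S: "endpoints D F \<subseteq> verts D" by (auto simp: endpoints_def)
  show "colorable k D \<longleftrightarrow> colorable k (D \<restriction> endpoints D F)"
  proof
    assume "colorable k D"
    with S show "colorable k (D \<restriction> endpoints D F)"
      unfolding colorable_def by (blast intro: is_coloring_induced)
  next
    assume "colorable k (D \<restriction> endpoints D F)"
    then obtain c where c: "is_coloring k (D \<restriction> endpoints D F) c" unfolding colorable_def by blast
    \<comment> \<open>Existence comes from running the algorithm on some enumeration of the finite
      data.\<close>
    have "finite F" using F by (rule finite_subset) simp
    moreover have "finite (endpoints D F)" using S by (rule finite_subset) simp
    ultimately have "\<exists>fs. lists_set fs (arc_to_ends D ` F)"
      "\<exists>cs. lists_set cs ((\<lambda>v. (v, c v)) ` endpoints D F)" "\<exists>vs. set vs = verts D"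
      using finite_distinct_list[of "arc_to_ends D ` F"]
        finite_distinct_list[of "(\<lambda>v. (v, c v)) ` endpoints D F"] finite_list[of "verts D"]
      unfolding lists_set_def by auto
    then obtain vs fs cs where "set vs = verts D" "lists_set fs (arc_to_ends D ` F)"
      "lists_set cs ((\<lambda>v. (v, c v)) ` endpoints D F)"
      by blast
    with * c show "colorable k D"
      unfolding colorable_def by (blast dest: recolor_is_coloring)
  qed
next
  \<comment> \<open>The projections follow the nesting in \<open>encodes_instance\<close> and
    extract \<open>k\<close>, the vertices, F and the coloring of V(F).\<close>
  let ?f = "\<lambda>x. recolor_tree (left x) (left (right x)) (left (right (right (right x))))
    (right (right (right (right x))))"
  have "ptime ?f" by (intro ptime_recolor_tree ptime_intros)
  from ptime_computes[OF this] obtain prog p where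
    prog: "\<forall>x. \<exists>t. computes prog x t (?f x) \<and> t \<le> poly p (nodes x)"
    by (elim exE)
  show "\<exists>(prog :: com) (p :: nat poly).
        \<forall>(k::nat) (D :: nat pair_pre_digraph) F c x.
          1 \<le> k \<and> pair_digraph D \<and> feedback_arc_set (with_proj D) F \<and> card F \<le> k^2 - 1 \<and>
          is_coloring k (with_proj D \<restriction> endpoints (with_proj D) F) c \<and>
          encodes_instance k D F c x \<longrightarrow>
          (\<exists>t y c'. computes prog x t y \<and> t \<le> poly p (nodes x) \<and>
                    is_coloring k (with_proj D) c' \<and> encodes_coloring (pverts D) c' y)"
  proof (intro exI[of _ prog] exI[of _ p] allI impI, elim conjE)
    fix k :: nat and D :: "nat pair_pre_digraph" and F c x
    assume k: "1 \<le> k" and "pair_digraph D" and F: "feedback_arc_set (with_proj D) F"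
      and card: "card F \<le> k\<^sup>2 - 1"
      and c: "is_coloring k (with_proj D \<restriction> endpoints (with_proj D) F) c"
      and x: "encodes_instance k D F c x"
    interpret pair_digraph D by fact
    have D: "digraph (with_proj D)" by unfold_locales
    from x obtain vs es fs cs where vs: "lists_set vs (pverts D)" and fs: "lists_set fs F"
      and cs: "lists_set cs ((\<lambda>v. (v, c v)) ` endpoints (with_proj D) F)"
      and x_eq: "x = Node (enc_nat k) (Node (enc_list enc_nat vs)
        (Node (enc_list enc_pair es) (Node (enc_list enc_pair fs) (enc_list enc_pair cs))))"
      unfolding encodes_instance_def encodes_coloring_def by blast
    \<comment> \<open>In a pair digraph every arc is its own pair of ends.\<close>
    have "arc_to_ends (with_proj D) ` F = F" by (auto simp: arc_to_ends_def)
    with fs have "lists_set fs (arc_to_ends (with_proj D) ` F)" by simp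
    from recolor_is_coloring[OF D F k card c _ this cs, of vs] vs
    obtain c' where c': "is_coloring k (with_proj D) c'"
      "lists_set (recolor k vs fs cs) ((\<lambda>v. (v, c' v)) ` pverts D)"
      by (auto simp: lists_set_def)
    have "?f x = enc_list enc_pair (recolor k vs fs cs)"
      by (simp add: x_eq recolor_tree_enc)
    with c'(2) have "encodes_coloring (pverts D) c' (?f x)"
      unfolding encodes_coloring_def by blast
    moreover obtain t where "computes prog x t (?f x)" "t \<le> poly p (nodes x)" using prog by blast
    ultimately show "\<exists>t y c'. computes prog x t y \<and> t \<le> poly p (nodes x) \<and>
        is_coloring k (with_proj D) c' \<and> encodes_coloring (pverts D) c' y"
      using c'(1) by blast
  qed
qed

end
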